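(* Let $m>0$, $d=(m+1)^{-1}$, and let $f$ be a polynomial with $f(0)=0$. Consider the Cauchy problem $$u_t = d\,(u^{m+1})_{xx}+f(u),\quad (t,x)\in(0,\infty)\times\mathbb{R},\qquad u(0,x)=u_0(x),\quad x\in\mathbb{R}.$$ Let $u$ and $v$ be weak solutions of this problem with initial data $u_0$ and $v_0$, respectively. Assume that for every $T>0$ one has $\operatorname{supp}u\cap\operatorname{supp}v=\emptyset$ in $Q_T=(0,T)\times\mathbb{R}$. Then $u+v$ is also a weak solution of the problem, with initial data $u_0+v_0$.
   Context: Initial data are continuous functions $u_0\in C^0(\mathbb{R})$ with $0\le u_0\le 1$. For $T>0$ put $Q_T=(0,T)\times\mathbb{R}$. A nonnegative function $u$ is a weak solution of the problem with initial datum $u_0$ if for each $r,T>0$ one has $u\in C(Q_T)\cap L^\infty(Q_T)$ and $$\int_0^T\!\!\int_{-r}^r\{u\phi_t+d\,u^{m+1}\phi_{xx}+f(u)\phi\}\,dx\,dt=\int_{-r}^r\{u(T,x)\phi(T,x)-u_0(x)\phi(0,x)\}\,dx+d\int_0^T\{u^{m+1}(t,r)\phi_x(t,r)-u^{m+1}(t,-r)\phi_x(t,-r)\}\,dt$$ for all $\phi\in C^{2,1}(\overline{Q_T})$ (twice continuously differentiable in $x$, continuously differentiable in $t$) with $\phi\ge0$ and $\phi(t,\pm r)=0$ for all $t\in[0,T]$. *)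

theory Defs
  imports "HOL-Analysis.Analysis" "HOL-Computational_Algebra.Polynomial"
begin

text \<open>Functions on space-time are curried, time first; a solution is a function on
  \<open>(0,\<infinity>) \<times> \<real>\<close>, so its values at nonpositive times are never used. The initial
  datum enters only through the integral identity.\<close>

definition Q :: "real \<Rightarrow> (real \<times> real) set" where
  "Q T = {0<..<T} \<times> UNIV"

definition supp_in :: "(real \<times> real) set \<Rightarrow> (real \<Rightarrow> real \<Rightarrow> real) \<Rightarrow> (real \<times> real) set" where
  "supp_in S u = top_of_set S closure_of {(t, x) \<in> S. u t x \<noteq> 0}"

definition L_infinity_on :: "(real \<times> real) set \<Rightarrow> (real \<Rightarrow> real \<Rightarrow> real) \<Rightarrow> bool" where
  "L_infinity_on S u \<longleftrightarrow>
     (\<lambda>(t, x). u t x) \<in> borel_measurable (lebesgue_on S) \<and>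
     (\<exists>C. AE (t, x) in lebesgue_on S. \<bar>u t x\<bar> \<le> C)"

definition initial_datum :: "(real \<Rightarrow> real) \<Rightarrow> bool" where
  "initial_datum u0 \<longleftrightarrow> continuous_on UNIV u0 \<and> (\<forall>x. 0 \<le> u0 x \<and> u0 x \<le> 1)"

text \<open>\<open>\<phi> \<in> C\<^sup>2\<^sup>,\<^sup>1([0,T] \<times> \<real>)\<close> with derivatives \<open>\<phi>t\<close>, \<open>\<phi>x\<close>, \<open>\<phi>xx\<close>, which are uniquely
  determined on \<open>[0,T] \<times> \<real>\<close>; the time derivative is one-sided at \<open>t = 0\<close> and \<open>t = T\<close>.\<close>

definition C21_on_closure_Q ::
  "real \<Rightarrow> (real \<Rightarrow> real \<Rightarrow> real) \<Rightarrow> (real \<Rightarrow> real \<Rightarrow> real) \<Rightarrow>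
    (real \<Rightarrow> real \<Rightarrow> real) \<Rightarrow> (real \<Rightarrow> real \<Rightarrow> real) \<Rightarrow> bool" where
  "C21_on_closure_Q T \<phi> \<phi>t \<phi>x \<phi>xx \<longleftrightarrow>
     (\<forall>t\<in>{0..T}. \<forall>x.
        ((\<lambda>s. \<phi> s x) has_real_derivative \<phi>t t x) (at t within {0..T}) \<and>
        ((\<lambda>y. \<phi> t y) has_real_derivative \<phi>x t x) (at x) \<and>
        ((\<lambda>y. \<phi>x t y) has_real_derivative \<phi>xx t x) (at x)) \<and>
     continuous_on ({0..T} \<times> UNIV) (\<lambda>(t, x). \<phi> t x) \<and>
     continuous_on ({0..T} \<times> UNIV) (\<lambda>(t, x). \<phi>t t x) \<and>
     continuous_on ({0..T} \<times> UNIV) (\<lambda>(t, x). \<phi>x t x) \<and>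
     continuous_on ({0..T} \<times> UNIV) (\<lambda>(t, x). \<phi>xx t x)"

text \<open>Weak solutions of \<open>u\<^sub>t = d (u\<^sup>m\<^sup>+\<^sup>1)\<^sub>x\<^sub>x + f(u)\<close>. Test functions live on \<open>[0,T] \<times> \<real>\<close> and are
  nonnegative there; together with \<open>\<phi>(t,\<plusminus>r) = 0\<close> this makes the lateral boundary terms vanish,
  but they are kept as in the usual definition. That \<open>u0\<close> is an admissible initial datum is part
  of the notion of a solution with initial datum \<open>u0\<close>.\<close>

definition weak_solution ::
  "real \<Rightarrow> real \<Rightarrow> real poly \<Rightarrow> (real \<Rightarrow> real \<Rightarrow> real) \<Rightarrow> (real \<Rightarrow> real) \<Rightarrow> bool" where
  "weak_solution m d f u u0 \<longleftrightarrow>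
     initial_datum u0 \<and>
     (\<forall>t>0. \<forall>x. 0 \<le> u t x) \<and>
     (\<forall>r>0. \<forall>T>0.
        continuous_on (Q T) (\<lambda>(t, x). u t x) \<and>
        L_infinity_on (Q T) u \<and>
        (\<forall>\<phi> \<phi>t \<phi>x \<phi>xx.
           C21_on_closure_Q T \<phi> \<phi>t \<phi>x \<phi>xx \<and>
           (\<forall>t\<in>{0..T}. \<forall>x. 0 \<le> \<phi> t x) \<and>
           (\<forall>t\<in>{0..T}. \<phi> t r = 0 \<and> \<phi> t (- r) = 0) \<longrightarrow>
           (LBINT t:{0<..<T}. LBINT x:{- r..r}.
              u t x * \<phi>t t x + d * (u t x powr (m + 1)) * \<phi>xx t x + poly f (u t x) * \<phi> t x)
           = (LBINT x:{- r..r}. u T x * \<phi> T x - u0 x * \<phi> 0 x)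
             + d * (LBINT t:{0<..<T}.
                 (u t r powr (m + 1)) * \<phi>x t r - (u t (- r) powr (m + 1)) * \<phi>x t (- r))))"

end

theory Submission
  imports Defs
begin

text \<open>Since \<open>u v = 0\<close> and \<open>f(0) = 0\<close>, every nonlinear term of \<open>u + v\<close> splits, so the integral identity
  is additive. The point that needs an argument is \<open>u0 + v0 \<le> 1\<close>: initial data are attained only
  weakly, so disjoint supports for \<open>t > 0\<close> do not immediately give \<open>u0 v0 = 0\<close>. Put
  \<open>U(t,x) = \<integral>\<^sub>0\<^sup>t u\<^sup>m\<^sup>+\<^sup>1 ds\<close>. Then \<open>U\<^sub>t = (d U\<^sub>x\<^sub>x + u0 + O(t))\<^sup>m\<^sup>+\<^sup>1\<close> with \<open>U(0,\<cdot>) = 0\<close>, and a barrier argument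
  gives \<open>U(t,x)/t \<rightarrow> u0(x)\<^sup>m\<^sup>+\<^sup>1\<close>; likewise for \<open>v\<close>, with time integral \<open>V\<close>, and, because \<open>u v = 0\<close>, for
  \<open>U + V\<close> with limit \<open>(u0 + v0)\<^sup>m\<^sup>+\<^sup>1\<close>. Hence \<open>u0\<^sup>m\<^sup>+\<^sup>1 + v0\<^sup>m\<^sup>+\<^sup>1 = (u0 + v0)\<^sup>m\<^sup>+\<^sup>1\<close>, which forces \<open>u0 v0 = 0\<close>.\<close>

subsection \<open>Second differences and splines\<close>

definition second_diff :: "real \<Rightarrow> (real \<Rightarrow> real) \<Rightarrow> real \<Rightarrow> real" where
  "second_diff h f x = f (x + h) + f (x - h) - 2 * f x"

lemma second_diff_has_derivative:
  assumes "\<And>x. (f has_real_derivative f' x) (at x)"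
  shows "(second_diff h f has_real_derivative second_diff h f' x) (at x)"
proof -
  have "((\<lambda>x. f (x + h)) has_real_derivative f' (x + h)) (at x)"
    using assms DERIV_shift by blast
  moreover have "((\<lambda>x. f (x - h)) has_real_derivative f' (x - h)) (at x)"
    using DERIV_shift[of f "f' (x - h)" x "- h"] assms by simp
  ultimately show ?thesis
    unfolding second_diff_def[abs_def] by (auto intro!: derivative_eq_intros assms)
qed

lemma continuous_on_second_diff:
  assumes "continuous_on UNIV f"
  shows "continuous_on A (second_diff h f)"
proof -
  have *: "continuous_on A (\<lambda>x. f (g x))" if "continuous_on A g" for g :: "real \<Rightarrow> real"
    using continuous_on_compose2[OF assms that] by simp
  show ?thesis
    unfolding second_diff_def[abs_def]
    by (intro continuous_on_add continuous_on_diff continuous_on_mult continuous_on_const)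
      (auto intro!: * continuous_intros intro: continuous_on_subset[OF assms])
qed

lemma second_diff_nonneg:
  assumes "convex_on UNIV f"
  shows "0 \<le> second_diff h f x"
proof -
  have "f ((1 - 1/2) *\<^sub>R (x + h) + (1/2) *\<^sub>R (x - h)) \<le> (1 - 1/2) * f (x + h) + (1/2) * f (x - h)"
    by (rule convex_onD[OF assms]) auto
  then show ?thesis
    by (simp add: second_diff_def field_simps)
qed

text \<open>One application of l'Hopital's rule in \<open>h\<close> turns the quotient into
  \<open>(G' (x + h) - G' (x - h)) / (2 * h)\<close>, which tends to \<open>g\<close> because
  \<open>G'\<close> is differentiable at \<open>x\<close>.\<close>

lemma second_diff_tendsto:
  assumes G: "\<And>y. (G has_real_derivative G' y) (at y)"
    and G': "(G' has_real_derivative g) (at x)"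
  shows "((\<lambda>h. second_diff h G x / h\<^sup>2) \<longlongrightarrow> g) (at_right 0)"
proof (rule lhopital_right_0[where f' = "\<lambda>h. G' (x + h) - G' (x - h)" and g' = "\<lambda>h. 2 * h"])
  have [continuous_intros]: "isCont G y" for y
    using G DERIV_isCont by blast
  have "((\<lambda>h. second_diff h G x) \<longlongrightarrow> second_diff 0 G x) (at 0)"
    unfolding second_diff_def
    by (intro isCont_tendsto_compose[of _ G] tendsto_intros) (auto intro!: continuous_intros)
  then show "((\<lambda>h. second_diff h G x) \<longlongrightarrow> 0) (at_right 0)"
    by (auto simp: second_diff_def intro: filterlim_at_within_not_equal tendsto_mono[OF at_le])
  show "((\<lambda>h::real. h\<^sup>2) \<longlongrightarrow> 0) (at_right 0)"
    by (auto intro!: tendsto_eq_intros)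
  show "\<forall>\<^sub>F h::real in at_right 0. h\<^sup>2 \<noteq> 0" "\<forall>\<^sub>F h::real in at_right 0. 2 * h \<noteq> 0"
    by (auto simp: eventually_at_filter)
  show "\<forall>\<^sub>F h in at_right 0. ((\<lambda>h. second_diff h G x) has_real_derivative G' (x + h) - G' (x - h)) (at h)"
    unfolding second_diff_def
    by (intro always_eventually allI)
      (auto intro!: derivative_eq_intros DERIV_chain2[where f = G] G)
  show "\<forall>\<^sub>F h::real in at_right 0. (power2 has_real_derivative 2 * h) (at h)"
    by (auto intro!: derivative_eq_intros always_eventually)
  have "((\<lambda>h. G' (x + h)) has_real_derivative g * 1) (at 0)"
    by (rule DERIV_chain2[where f = G']) (auto intro!: derivative_eq_intros G')
  moreover have "((\<lambda>h. G' (x - h)) has_real_derivative g * (- 1)) (at 0)"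
    by (rule DERIV_chain2[where f = G']) (auto intro!: derivative_eq_intros G')
  ultimately have "((\<lambda>h. G' (x + h) - G' (x - h)) has_real_derivative 2 * g) (at 0)"
    by (auto intro!: derivative_eq_intros)
  then have "((\<lambda>h. (G' (x + h) - G' (x - h)) / h) \<longlongrightarrow> 2 * g) (at 0)"
    by (simp add: DERIV_def)
  then have "((\<lambda>h. (G' (x + h) - G' (x - h)) / h) \<longlongrightarrow> 2 * g) (at_right 0)"
    by (rule tendsto_within_subset) simp
  then have "((\<lambda>h. (G' (x + h) - G' (x - h)) / h / 2) \<longlongrightarrow> 2 * g / 2) (at_right 0)"
    by (rule tendsto_divide[OF _ tendsto_const]) simp
  then show "((\<lambda>h. (G' (x + h) - G' (x - h)) / (2 * h)) \<longlongrightarrow> g) (at_right 0)"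
    by (simp add: field_simps)
qed

text \<open>Off 0 the function agrees locally with 0 or with a monomial. At 0 its difference
  quotient is at most \<open>(max 0 h) ^ n\<close> in absolute value, which tends to 0 because
  \<open>n\<close> is positive.\<close>

lemma pos_part_power_has_derivative:
  fixes y :: real
  assumes "0 < n"
  shows "((\<lambda>y. (max 0 y) ^ Suc n / fact (Suc n)) has_real_derivative (max 0 y) ^ n / fact n) (at y)"
proof -
  consider "y < 0" | "y = 0" | "0 < y" by linarith
  then show ?thesis
  proof cases
    case 1
    have "((\<lambda>y::real. 0) has_real_derivative (max 0 y) ^ n / fact n) (at y)"
      using 1 assms by (auto simp: power_0_left)
    then show ?thesis
      by (rule has_field_derivative_transform_within_open[of _ _ _ "{..<0}"]) (use 1 in auto)
  next
    case 3
    have "((\<lambda>y::real. y ^ Suc n / fact (Suc n)) has_real_derivative (max 0 y) ^ n / fact n) (at y)"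
      using DERIV_cdivide[OF DERIV_pow[of "Suc n" y], of "fact (Suc n)"] 3
      by (simp del: of_nat_Suc)
    then show ?thesis
      by (rule has_field_derivative_transform_within_open[of _ _ _ "{0<..}"]) (use 3 in auto)
  next
    case 2
    have "((\<lambda>h::real. (max 0 h) ^ n * (max 0 h / h) / fact (Suc n)) \<longlongrightarrow> 0) (at 0)"
    proof (rule Lim_null_comparison)
      show "\<forall>\<^sub>F h::real in at 0. norm ((max 0 h) ^ n * (max 0 h / h) / fact (Suc n)) \<le> (max 0 h) ^ n"
      proof (intro always_eventually allI)
        fix h :: real
        have "q / F \<le> 1" "0 \<le> q / F" if "1 \<le> F" "q \<le> 1" "0 \<le> q" for q F :: real
          using that by (auto simp: divide_le_eq)
        moreover have "max 0 h / h \<le> 1" "0 \<le> max 0 h / h"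
          by (auto simp: max_def)
        ultimately have "(max 0 h / h) / fact (Suc n) \<le> 1" "0 \<le> (max 0 h / h) / fact (Suc n)"
          using fact_ge_1 by blast+
        then have "(max 0 h) ^ n * ((max 0 h / h) / fact (Suc n)) \<le> (max 0 h) ^ n * 1"
          and "0 \<le> (max 0 h) ^ n * ((max 0 h / h) / fact (Suc n))"
          by (metis mult_left_mono zero_le_power max.cobounded1,
            metis mult_nonneg_nonneg zero_le_power max.cobounded1)
        moreover have "(max 0 h) ^ n * (max 0 h / h) / fact (Suc n) = (max 0 h) ^ n * ((max 0 h / h) / fact (Suc n))"
          by simp
        ultimately show "norm ((max 0 h) ^ n * (max 0 h / h) / fact (Suc n)) \<le> (max 0 h) ^ n"
          by (simp only: real_norm_def abs_of_nonneg mult_1_right)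
      qed
      have "((\<lambda>h::real. (max 0 h) ^ n) \<longlongrightarrow> (max 0 0) ^ n) (at 0)"
        by (intro tendsto_intros)
      then show "((\<lambda>h::real. (max 0 h) ^ n) \<longlongrightarrow> 0) (at 0)"
        by (simp only: max.idem zero_power[OF assms])
    qed
    then show ?thesis
      using 2 assms by (simp add: DERIV_def mult.commute power_0_left)
  qed
qed


text \<open>For \<open>n = 3\<close> these are the nonnegative test functions; their second derivatives, \<open>n = 1\<close>, are second
  differences of tents, which act on continuous functions like second differences as \<open>\<delta> \<rightarrow> 0\<close>.\<close>
definition spline :: "real \<Rightarrow> real \<Rightarrow> nat \<Rightarrow> real \<Rightarrow> real" where
  "spline h \<delta> n = second_diff h (second_diff \<delta> (\<lambda>y. (max 0 y) ^ n / fact n))"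

lemma continuous_on_pos_part_power: "continuous_on A (\<lambda>y::real. (max 0 y) ^ n / fact n)"
  by (intro continuous_intros) auto

lemma continuous_on_spline: "continuous_on A (spline h \<delta> n)"
  unfolding spline_def
  by (intro continuous_on_second_diff continuous_on_pos_part_power)

lemma spline_has_derivative:
  assumes "0 < n"
  shows "(spline h \<delta> (Suc n) has_real_derivative spline h \<delta> n y) (at y)"
  unfolding spline_def
  by (intro second_diff_has_derivative pos_part_power_has_derivative assms)

lemma second_diff_linear_nonneg: "0 \<le> second_diff \<delta> (\<lambda>y. (max 0 y) ^ Suc 0 / fact (Suc 0)) x"
  by (auto simp: second_diff_def max_def)

text \<open>Differentiating the inner second difference twice lowers the truncated cube to a
  truncated linear function, whose second difference is nonnegative. The inner function is therefore
  convex, and so its second difference with step \<open>h\<close> is nonnegative too.\<close>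

lemma spline_nonneg: "0 \<le> spline h \<delta> 3 y"
  unfolding spline_def
proof (rule second_diff_nonneg, rule f''_ge0_imp_convex)
  show "(second_diff \<delta> (\<lambda>y. (max 0 y) ^ 3 / fact 3) has_real_derivative
      second_diff \<delta> (\<lambda>y. (max 0 y) ^ Suc (Suc 0) / fact (Suc (Suc 0))) x) (at x)" for x
    using pos_part_power_has_derivative[of 2]
    by (intro second_diff_has_derivative) (simp add: numeral_eq_Suc del: fact_Suc)
  show "(second_diff \<delta> (\<lambda>y. (max 0 y) ^ Suc (Suc 0) / fact (Suc (Suc 0))) has_real_derivative
      second_diff \<delta> (\<lambda>y. (max 0 y) ^ Suc 0 / fact (Suc 0)) x) (at x)" for x
    by (intro second_diff_has_derivative pos_part_power_has_derivative) simp
qed (use second_diff_linear_nonneg in auto)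

text \<open>Beyond the support only polynomials of degree at most three are left, and these are
  annihilated by the fourth difference.\<close>
lemma spline_eq_0:
  assumes "0 \<le> h" "0 \<le> \<delta>" "h + \<delta> \<le> \<bar>y\<bar>" "n \<in> {1, 2, 3}"
  shows "spline h \<delta> n y = 0"
proof (cases "0 \<le> y")
  case True
  then have "max 0 (y + h + \<delta>) = y + h + \<delta>" "max 0 (y + h - \<delta>) = y + h - \<delta>" "max 0 (y + h) = y + h"
    "max 0 (y - h + \<delta>) = y - h + \<delta>" "max 0 (y - h - \<delta>) = y - h - \<delta>" "max 0 (y - h) = y - h"
    "max 0 (y + \<delta>) = y + \<delta>" "max 0 (y - \<delta>) = y - \<delta>" "max 0 y = y"
    using assms by auto
  then show ?thesis
    using assms(4)
    by (auto simp: spline_def second_diff_def field_simps power2_eq_square power3_eq_cube fact_numeral)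
next
  case False
  then have "max 0 (y + h + \<delta>) = 0" "max 0 (y + h - \<delta>) = 0" "max 0 (y + h) = 0"
    "max 0 (y - h + \<delta>) = 0" "max 0 (y - h - \<delta>) = 0" "max 0 (y - h) = 0"
    "max 0 (y + \<delta>) = 0" "max 0 (y - \<delta>) = 0" "max 0 y = 0"
    using assms by auto
  then show ?thesis
    using assms(4) by (auto simp: spline_def second_diff_def)
qed

section \<open>Tent functions, and pointwise second differences recovered from integral
  identities\<close>

text \<open>For positive \<delta> this is the hat function of height \<delta> supported on
  \<open>{- \<delta>..\<delta>}\<close>; divided by its mass \<open>\<delta>\<^sup>2\<close> it is
  an approximate identity as \<delta> tends to 0.\<close>

definition tent :: "real \<Rightarrow> real \<Rightarrow> real" where
  "tent \<delta> = second_diff \<delta> (max 0)"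

lemma continuous_on_tent: "continuous_on A (\<lambda>y. tent \<delta> (y - z))"
  unfolding tent_def second_diff_def by (intro continuous_intros)

lemma tent_nonneg: "0 \<le> tent \<delta> y"
  by (auto simp: tent_def second_diff_def max_def)

lemma tent_eq_0: "0 \<le> \<delta> \<Longrightarrow> \<delta> \<le> \<bar>y\<bar> \<Longrightarrow> tent \<delta> y = 0"
  by (auto simp: tent_def second_diff_def max_def)

lemma spline_1_eq_tent: "spline h \<delta> 1 (y - x) = tent \<delta> (y - (x - h)) + tent \<delta> (y - (x + h)) - 2 * tent \<delta> (y - x)"
  by (simp add: spline_def tent_def second_diff_def algebra_simps)

text \<open>An antiderivative is the second difference of the truncated square divided by 2: it is 0
  to the left of the support and constantly \<open>\<delta>\<^sup>2\<close> to the right of it. The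
  condition on \<open>r\<close> places the whole support inside the interval.\<close>

lemma tent_has_integral:
  assumes "0 \<le> \<delta>" "\<bar>z\<bar> + \<delta> \<le> r"
  shows "((\<lambda>y. tent \<delta> (y - z)) has_integral \<delta>\<^sup>2) {-r..r}"
proof -
  define S where "S = second_diff \<delta> (\<lambda>y. (max 0 y) ^ Suc 1 / fact (Suc 1))"
  have S: "(S has_real_derivative tent \<delta> y) (at y)" for y
    using second_diff_has_derivative[OF pos_part_power_has_derivative[of 1]]
    by (simp add: S_def tent_def)
  have "((\<lambda>y. S (y - z)) has_real_derivative tent \<delta> (y - z)) (at y)" for y
    using DERIV_shift[of S "tent \<delta> (y - z)" y "- z"] S by simp
  then have "((\<lambda>y. tent \<delta> (y - z)) has_integral S (r - z) - S (- r - z)) {-r..r}"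
    using assms by (intro fundamental_theorem_of_calculus)
      (auto simp: has_real_derivative_iff_has_vector_derivative[symmetric] intro: DERIV_subset)
  moreover have "max 0 (r - z + \<delta>) = r - z + \<delta>" "max 0 (r - z - \<delta>) = r - z - \<delta>" "max 0 (r - z) = r - z"
    "max 0 (- r - z + \<delta>) = 0" "max 0 (- r - z - \<delta>) = 0" "max 0 (- r - z) = 0"
    using assms by auto
  then have "S (r - z) - S (- r - z) = \<delta>\<^sup>2"
    by (simp add: S_def second_diff_def) (simp add: field_simps power2_eq_square)
  ultimately show ?thesis by simp
qed

text \<open>The weight is nonnegative with mass \<open>\<delta>\<^sup>2\<close>, and on its support
  \<open>H\<close> stays between \<open>H z - e\<close> and \<open>H z + e\<close>.\<close>

lemma tent_mean_value:
  assumes H: "continuous_on UNIV H" and \<delta>: "0 \<le> \<delta>" "\<bar>z\<bar> + \<delta> \<le> r"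
    and e: "\<And>y. \<bar>y - z\<bar> \<le> \<delta> \<Longrightarrow> \<bar>H y - H z\<bar> \<le> e"
  shows "\<bar>integral {-r..r} (\<lambda>y. H y * tent \<delta> (y - z)) - \<delta>\<^sup>2 * H z\<bar> \<le> \<delta>\<^sup>2 * e"
proof -
  have t: "((\<lambda>y. c * tent \<delta> (y - z)) has_integral c * \<delta>\<^sup>2) {-r..r}" for c
    by (intro has_integral_mult_right tent_has_integral \<delta>)
  have i: "(\<lambda>y. H y * tent \<delta> (y - z)) integrable_on {-r..r}"
    by (intro integrable_continuous_real continuous_on_mult continuous_on_tent
        continuous_on_subset[OF H]) auto
  have le: "integral {-r..r} (\<lambda>y. H y * tent \<delta> (y - z)) \<le> (H z + e) * \<delta>\<^sup>2"
  proof (rule has_integral_le[OF integrable_integral[OF i] t])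
    show "H y * tent \<delta> (y - z) \<le> (H z + e) * tent \<delta> (y - z)" for y
      using e[of y] tent_nonneg[of \<delta> "y - z"] tent_eq_0[OF \<delta>(1), of "y - z"]
      by (cases "\<bar>y - z\<bar> \<le> \<delta>") (auto intro!: mult_right_mono)
  qed
  moreover have "(H z - e) * \<delta>\<^sup>2 \<le> integral {-r..r} (\<lambda>y. H y * tent \<delta> (y - z))"
  proof (rule has_integral_le[OF t integrable_integral[OF i]])
    show "(H z - e) * tent \<delta> (y - z) \<le> H y * tent \<delta> (y - z)" for y
      using e[of y] tent_nonneg[of \<delta> "y - z"] tent_eq_0[OF \<delta>(1), of "y - z"]
      by (cases "\<bar>y - z\<bar> \<le> \<delta>") (auto intro!: mult_right_mono)
  qed
  ultimately show ?thesis
    by (simp add: abs_le_iff algebra_simps)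
qed

text \<open>Since \<open>spline h \<delta> 1\<close> is a second difference of tents, testing
  \<open>H\<close> against it gives \<open>\<delta>\<^sup>2\<close> times the second difference of
  \<open>H\<close>, up to an error governed by the oscillation of \<open>H\<close> near three
  points. Dividing by \<open>\<delta>\<^sup>2\<close> makes this error arbitrarily small.\<close>

lemma second_diff_eq_0_of_weak:
  assumes H: "continuous_on UNIV H" and h: "0 < h"
    and weak: "\<And>\<delta> r. 0 < \<delta> \<Longrightarrow> \<bar>x\<bar> + h + \<delta> \<le> r \<Longrightarrow>
      integral {-r..r} (\<lambda>y. H y * spline h \<delta> 1 (y - x)) = 0"
  shows "second_diff h H x = 0"
proof -
  have "\<bar>second_diff h H x\<bar> \<le> 0 + \<epsilon>" if "0 < \<epsilon>" for \<epsilon>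
  proof -
    \<comment> \<open>The tents at \<open>x + h\<close>, \<open>x - h\<close> and \<open>x\<close>
      enter with weights 1, 1 and 2, so the errors add up to four times \<open>e\<close>.\<close>
    define e where "e = \<epsilon> / 4"
    have "0 < e" using that by (simp add: e_def)
    have "\<exists>\<delta>>0. \<forall>y. \<bar>y - z\<bar> \<le> \<delta> \<longrightarrow> \<bar>H y - H z\<bar> \<le> e" for z
    proof -
      from H obtain d where "d > 0" "\<And>y. \<bar>y - z\<bar> < d \<Longrightarrow> \<bar>H y - H z\<bar> < e"
        using \<open>0 < e\<close> unfolding continuous_on_iff dist_real_def by (metis UNIV_I)
      then show ?thesis
        by (intro exI[of _ "d / 2"]) (auto intro!: less_imp_le)
    qed
    then obtain D where D: "\<And>z. 0 < D z" "\<And>z y. \<bar>y - z\<bar> \<le> D z \<Longrightarrow> \<bar>H y - H z\<bar> \<le> e"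
      by metis
    define \<delta> where "\<delta> = Min {D x, D (x + h), D (x - h)}"
    have \<delta>: "0 < \<delta>" "\<delta> \<le> D x" "\<delta> \<le> D (x + h)" "\<delta> \<le> D (x - h)"
      using D(1) by (auto simp: \<delta>_def)
    define r where "r = \<bar>x\<bar> + h + \<delta>"
    define A where "A z = integral {-r..r} (\<lambda>y. H y * tent \<delta> (y - z))" for z
    have A: "\<bar>A z - \<delta>\<^sup>2 * H z\<bar> \<le> \<delta>\<^sup>2 * e" if "z \<in> {x, x + h, x - h}" for z
      unfolding A_def
    proof (rule tent_mean_value[OF H])
      show "\<bar>H y - H z\<bar> \<le> e" if "\<bar>y - z\<bar> \<le> \<delta>" for y
        using D(2)[of y z] \<delta> that \<open>z \<in> _\<close> by auto
    qed (use \<delta> h that in \<open>auto simp: r_def\<close>)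
    have i: "(\<lambda>y. H y * tent \<delta> (y - z)) integrable_on {-r..r}" for z
      by (intro integrable_continuous_real continuous_on_mult continuous_on_tent
          continuous_on_subset[OF H]) auto
    have "0 = integral {-r..r} (\<lambda>y. H y * spline h \<delta> 1 (y - x))"
      using weak[of \<delta> r] \<delta> by (simp add: r_def)
    also have "\<dots> = integral {-r..r} (\<lambda>y. H y * tent \<delta> (y - (x - h)) + H y * tent \<delta> (y - (x + h))
        - 2 * (H y * tent \<delta> (y - x)))"
      unfolding spline_1_eq_tent by (simp add: algebra_simps)
    also have "\<dots> = A (x - h) + A (x + h) - 2 * A x"
      unfolding A_def using i
      by (subst integral_diff integral_add, (intro integrable_add integrable_on_mult_right i)+)+ simp
    finally have "0 = A (x - h) + A (x + h) - 2 * A x" .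
    moreover have "\<delta>\<^sup>2 * second_diff h H x = \<delta>\<^sup>2 * H (x + h) + \<delta>\<^sup>2 * H (x - h) - 2 * (\<delta>\<^sup>2 * H x)"
      "\<delta>\<^sup>2 * \<epsilon> = 4 * (\<delta>\<^sup>2 * e)"
      by (simp_all add: second_diff_def e_def algebra_simps)
    moreover have "\<bar>A x - \<delta>\<^sup>2 * H x\<bar> \<le> \<delta>\<^sup>2 * e" "\<bar>A (x + h) - \<delta>\<^sup>2 * H (x + h)\<bar> \<le> \<delta>\<^sup>2 * e"
      "\<bar>A (x - h) - \<delta>\<^sup>2 * H (x - h)\<bar> \<le> \<delta>\<^sup>2 * e"
      using A by auto
    ultimately have "\<bar>\<delta>\<^sup>2 * second_diff h H x\<bar> \<le> \<delta>\<^sup>2 * \<epsilon>"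
      by linarith
    then show ?thesis
      using \<delta> by (simp add: abs_mult)
  qed
  then have "\<bar>second_diff h H x\<bar> \<le> 0"
    by (rule field_le_epsilon)
  then show ?thesis by simp
qed


lemma double_antiderivative_exists:
  fixes g :: "real \<Rightarrow> real"
  assumes g: "continuous_on UNIV g"
  obtains G G' where "\<And>x. (G has_real_derivative G' x) (at x)" "\<And>x. (G' has_real_derivative g x) (at x)"
proof -
  have ex: "\<exists>F. \<forall>x. (F has_real_derivative k x) (at x)" if k: "continuous_on UNIV k" for k :: "real \<Rightarrow> real"
  proof -
    have "\<exists>F. \<forall>x::real. - \<infinity> < ereal x \<longrightarrow> ereal x < \<infinity> \<longrightarrow> (F has_vector_derivative k x) (at x)"
      using k by (intro einterval_antiderivative) (auto simp: continuous_on_eq_continuous_at)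
    then show ?thesis
      by (auto simp: has_real_derivative_iff_has_vector_derivative)
  qed
  obtain G' where G': "\<And>x. (G' has_real_derivative g x) (at x)"
    using ex[OF g] by auto
  then have "continuous_on UNIV G'"
    by (meson DERIV_continuous_on UNIV_I has_field_derivative_at_within)
  then obtain G where "\<And>x. (G has_real_derivative G' x) (at x)"
    using ex by metis
  then show thesis using G' that by blast
qed

text \<open>A du Bois-Reymond argument: \<open>d * U\<close> differs from a classical double antiderivative of \<open>g\<close>
  by a function whose second differences vanish.\<close>
lemma second_diff_tendsto_of_weak:
  assumes U: "continuous_on UNIV U" and g: "continuous_on UNIV g" and d: "d \<noteq> 0"
    and weak: "\<And>h \<delta> r. 0 < h \<Longrightarrow> 0 < \<delta> \<Longrightarrow> \<bar>x\<bar> + h + \<delta> \<le> r \<Longrightarrow>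
      integral {-r..r} (\<lambda>y. d * U y * spline h \<delta> 1 (y - x)) = integral {-r..r} (\<lambda>y. g y * spline h \<delta> 3 (y - x))"
  shows "((\<lambda>h. second_diff h U x / h\<^sup>2) \<longlongrightarrow> g x / d) (at_right 0)"
proof -
  obtain G G' where G: "\<And>y. (G has_real_derivative G' y) (at y)"
    and G': "\<And>y. (G' has_real_derivative g y) (at y)"
    using double_antiderivative_exists[OF g] by blast
  have contG: "continuous_on A G" for A
    using G by (meson DERIV_continuous_on has_field_derivative_at_within)
  have sub: "continuous_on A U" for A
    using U continuous_on_subset by blast
  have cs: "continuous_on A (\<lambda>y. spline h \<delta> n (y - x))" for A h \<delta> n
    by (intro continuous_on_compose2[OF continuous_on_spline[of UNIV]] continuous_intros) auto
  have "second_diff h (\<lambda>y. d * U y - G y) x = 0" if h: "0 < h" for h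
  proof (rule second_diff_eq_0_of_weak[OF _ h])
    show "continuous_on UNIV (\<lambda>y. d * U y - G y)"
      by (intro continuous_intros sub contG)
    fix \<delta> r :: real assume \<delta>: "0 < \<delta>" and r: "\<bar>x\<bar> + h + \<delta> \<le> r"
    have s: "((\<lambda>y. spline h \<delta> (Suc n) (y - x)) has_real_derivative spline h \<delta> n (y - x)) (at y)"
      if "0 < n" for n y
      using iffD1[OF DERIV_shift spline_has_derivative[OF that, of h \<delta> "y + - x"]] by simp
    \<comment> \<open>Two integrations by parts in one: the terms
      \<open>G' y * spline h \<delta> 2 (y - x)\<close> cancel, and the primitive vanishes at both
      endpoints because they lie outside the support of the splines.\<close>
    have "((\<lambda>y. G y * spline h \<delta> 2 (y - x) - G' y * spline h \<delta> 3 (y - x)) has_real_derivative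
        G y * spline h \<delta> 1 (y - x) - g y * spline h \<delta> 3 (y - x)) (at y)" for y
      using s[of 1 y] s[of 2 y]
      by (auto intro!: derivative_eq_intros G G' simp: numeral_eq_Suc)
    then have "((\<lambda>y. G y * spline h \<delta> 1 (y - x) - g y * spline h \<delta> 3 (y - x)) has_integral
        (G r * spline h \<delta> 2 (r - x) - G' r * spline h \<delta> 3 (r - x))
        - (G (-r) * spline h \<delta> 2 (-r - x) - G' (-r) * spline h \<delta> 3 (-r - x))) {-r..r}"
      using r \<delta> h by (intro fundamental_theorem_of_calculus)
        (auto simp: has_real_derivative_iff_has_vector_derivative[symmetric] intro: DERIV_subset)
    moreover have "spline h \<delta> n (r - x) = 0" "spline h \<delta> n (- r - x) = 0" if "n \<in> {2, 3}" for n
      using r \<delta> h that by (auto intro!: spline_eq_0)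
    ultimately have z: "((\<lambda>y. G y * spline h \<delta> 1 (y - x) - g y * spline h \<delta> 3 (y - x)) has_integral 0) {-r..r}"
      by simp
    have i: "(\<lambda>y. G y * spline h \<delta> 1 (y - x)) integrable_on {-r..r}"
      "(\<lambda>y. g y * spline h \<delta> 3 (y - x)) integrable_on {-r..r}"
      "(\<lambda>y. d * U y * spline h \<delta> 1 (y - x)) integrable_on {-r..r}"
      by (intro integrable_continuous_real continuous_intros contG cs sub continuous_on_subset[OF g] subset_UNIV)+
    have "integral {-r..r} (\<lambda>y. G y * spline h \<delta> 1 (y - x)) = integral {-r..r} (\<lambda>y. g y * spline h \<delta> 3 (y - x))"
      using integral_unique[OF z] unfolding integral_diff[OF i(1,2)] by simp
    with i show "integral {-r..r} (\<lambda>y. (d * U y - G y) * spline h \<delta> 1 (y - x)) = 0"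
      using weak[OF h \<delta> r] by (simp add: left_diff_distrib integral_diff)
  qed
  then have "second_diff h G x = d * second_diff h U x" if "0 < h" for h
    using that by (simp add: second_diff_def algebra_simps)
  then have "second_diff h U x / h\<^sup>2 = second_diff h G x / h\<^sup>2 / d" if "0 < h" for h
    using that d by simp
  then have "\<forall>\<^sub>F h in at_right 0. second_diff h G x / h\<^sup>2 / d = second_diff h U x / h\<^sup>2"
    by (auto simp: eventually_at_right_less eventually_at_filter)
  moreover have "((\<lambda>h. second_diff h G x / h\<^sup>2 / d) \<longlongrightarrow> g x / d) (at_right 0)"
    by (intro tendsto_divide second_diff_tendsto[OF G G'] tendsto_const d)
  ultimately show ?thesis
    by (rule Lim_transform_eventually[rotated])
qed

subsection \<open>A maximum principle near the initial time\<close>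

text \<open>The proof compares with the barrier \<open>(k + \<eta>) t + K t (x - x0)\<^sup>2 / a\<^sup>2\<close> with \<open>\<eta> \<down> 0\<close>: at an
  interior maximum of the difference the symmetric second derivative of \<open>P\<close> is small, so that the
  time derivative is at most \<open>k\<close>, which is less than that of the barrier.\<close>
lemma barrier_bound:
  fixes P Pt Pxx :: "real \<Rightarrow> real \<Rightarrow> real"
  assumes a: "0 < a" and K: "0 \<le> K"
    and cont: "continuous_on ({0..t0} \<times> {x0 - a..x0 + a}) (\<lambda>(t, x). P t x)"
    and init: "\<And>x. \<bar>x - x0\<bar> \<le> a \<Longrightarrow> P 0 x \<le> 0"
    and lateral: "\<And>t x. 0 \<le> t \<Longrightarrow> t \<le> t0 \<Longrightarrow> \<bar>x - x0\<bar> = a \<Longrightarrow> P t x \<le> (k + K) * t"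
    and deriv: "\<And>t x. 0 < t \<Longrightarrow> t \<le> t0 \<Longrightarrow> \<bar>x - x0\<bar> < a \<Longrightarrow> ((\<lambda>s. P s x) has_real_derivative Pt t x) (at t)"
    and deriv2: "\<And>t x. 0 < t \<Longrightarrow> t \<le> t0 \<Longrightarrow> \<bar>x - x0\<bar> < a \<Longrightarrow>
      ((\<lambda>h. second_diff h (P t) x / h\<^sup>2) \<longlongrightarrow> Pxx t x) (at_right 0)"
    and bound: "\<And>t x. 0 < t \<Longrightarrow> t \<le> t0 \<Longrightarrow> \<bar>x - x0\<bar> < a \<Longrightarrow> Pxx t x \<le> 2 * K * t0 / a\<^sup>2 \<Longrightarrow> Pt t x \<le> k"
    and t: "0 \<le> t" "t \<le> t0"
  shows "P t x0 \<le> k * t"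
proof (rule field_le_epsilon)
  fix e :: real assume "0 < e"
  \<comment> \<open>Chosen so that \<open>\<eta> * t \<le> e\<close>; the summand 1 keeps the
    quotient meaningful at \<open>t = 0\<close>.\<close>
  define \<eta> where "\<eta> = e / (t + 1)"
  have \<eta>: "0 < \<eta>" using \<open>0 < e\<close> t by (simp add: \<eta>_def)
  define Z where "Z t x = P t x - (k + \<eta>) * t - K * t * (x - x0)\<^sup>2 / a\<^sup>2" for t x
  define R where "R = {0..t0} \<times> {x0 - a..x0 + a}"
  have "continuous_on R (\<lambda>p. Z (fst p) (snd p))"
    unfolding Z_def using cont a by (auto simp: R_def case_prod_beta intro!: continuous_intros)
  moreover have "compact R" "R \<noteq> {}"
    using t a by (auto simp: R_def compact_Times)
  ultimately obtain p where p: "p \<in> R" and max: "\<And>q. q \<in> R \<Longrightarrow> Z (fst q) (snd q) \<le> Z (fst p) (snd p)"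
    using continuous_attains_sup[of R "\<lambda>p. Z (fst p) (snd p)"] by blast
  obtain s x where sx: "p = (s, x)" by force
  have in_R: "(s', x') \<in> R \<longleftrightarrow> 0 \<le> s' \<and> s' \<le> t0 \<and> \<bar>x' - x0\<bar> \<le> a" for s' x'
    by (auto simp: R_def)
  have max: "Z s' x' \<le> Z s x" if "0 \<le> s'" "s' \<le> t0" "\<bar>x' - x0\<bar> \<le> a" for s' x'
    using max[of "(s', x')"] that in_R sx by simp
  have s: "0 \<le> s" "s \<le> t0" and x: "\<bar>x - x0\<bar> \<le> a"
    using p in_R sx by auto
  have "Z s x \<le> 0"
  proof (rule ccontr)
    assume "\<not> Z s x \<le> 0"
    then have pos: "0 < Z s x" by simp
    have "s \<noteq> 0"
      using pos init[OF x] by (auto simp: Z_def)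
    with s have s0: "0 < s" by simp
    \<comment> \<open>On the lateral sides the quadratic term of the barrier equals
      \<open>K * s\<close>, so the lateral bound already makes \<open>Z\<close> nonpositive
      there.\<close>
    have "\<bar>x - x0\<bar> \<noteq> a"
    proof
      assume *: "\<bar>x - x0\<bar> = a"
      then have "(x - x0)\<^sup>2 = a\<^sup>2" by (metis power2_abs)
      then have "Z s x = P s x - (k + \<eta>) * s - K * s"
        using a by (simp add: Z_def)
      moreover have "0 \<le> \<eta> * s" using \<eta> s by simp
      ultimately show False
        using lateral[OF s *] pos by (simp add: algebra_simps)
    qed
    with x have x': "\<bar>x - x0\<bar> < a" by simp
    \<comment> \<open>At a maximum in \<open>x\<close> the second differences of \<open>Z s\<close>
      are nonpositive, so those of \<open>P s\<close> are at most those of the parabola, namely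
      \<open>2 * K * s * h\<^sup>2 / a\<^sup>2\<close>; then \<open>s \<le> t0\<close> is
      used.\<close>
    have "second_diff h (P s) x / h\<^sup>2 \<le> 2 * K * t0 / a\<^sup>2" if h: "0 < h" "h < a - \<bar>x - x0\<bar>" for h
    proof -
      have "Z s (x + h) \<le> Z s x" "Z s (x - h) \<le> Z s x"
        using h s by (auto intro!: max)
      moreover define q where "q = K * s / a\<^sup>2"
      have Zs: "Z s y = P s y - (k + \<eta>) * s - q * (y - x0)\<^sup>2" for y
        by (simp add: Z_def q_def)
      have "q * (x + h - x0)\<^sup>2 + q * (x - h - x0)\<^sup>2 = 2 * (q * (x - x0)\<^sup>2) + 2 * (q * h\<^sup>2)"
        by (simp add: power2_eq_square algebra_simps)
      then have "second_diff h (P s) x = (Z s (x + h) - Z s x) + (Z s (x - h) - Z s x) + 2 * (q * h\<^sup>2)"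
        unfolding second_diff_def Zs by linarith
      ultimately have "second_diff h (P s) x \<le> 2 * K * s / a\<^sup>2 * h\<^sup>2"
        by (simp add: q_def)
      also have "\<dots> \<le> 2 * K * t0 / a\<^sup>2 * h\<^sup>2"
        using s K by (intro mult_right_mono divide_right_mono mult_left_mono) auto
      finally show ?thesis
        using h by (simp add: divide_le_eq)
    qed
    then have "\<forall>\<^sub>F h in at_right 0. second_diff h (P s) x / h\<^sup>2 \<le> 2 * K * t0 / a\<^sup>2"
      using x' unfolding eventually_at_right_field by (intro exI[of _ "a - \<bar>x - x0\<bar>"]) auto
    then have "Pxx s x \<le> 2 * K * t0 / a\<^sup>2"
      by (rule tendsto_upperbound[OF deriv2[OF s0 s(2) x']]) simp
    then have "Pt s x \<le> k"
      by (rule bound[OF s0 s(2) x'])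
    moreover have "((\<lambda>s. Z s x) has_real_derivative Pt s x - (k + \<eta>) - K * (x - x0)\<^sup>2 / a\<^sup>2) (at s)"
    proof -
      have "Z s x = P s x - (k + \<eta>) * s - K * (x - x0)\<^sup>2 / a\<^sup>2 * s" for s
        by (simp add: Z_def)
      then show ?thesis
        by (simp only:) (intro derivative_intros DERIV_cmult_Id deriv[OF s0 s(2) x'])
    qed
    moreover have "0 \<le> K * (x - x0)\<^sup>2 / a\<^sup>2"
      using K by simp
    \<comment> \<open>The time derivative of \<open>Z\<close> at the maximum is at most
      \<open>- \<eta>\<close>, so slightly earlier times would give larger values. Only earlier
      times are compared, since the maximum may sit at \<open>s = t0\<close>.\<close>
    ultimately obtain c where c: "c > 0" "\<And>h. 0 < h \<Longrightarrow> h < c \<Longrightarrow> Z s x < Z (s - h) x"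
      using DERIV_neg_dec_left[of "\<lambda>s. Z s x"] \<eta> by (smt (verit))
    define h where "h = min (c / 2) s"
    have "0 < h" "h < c" "h \<le> s"
      using c s0 by (auto simp: h_def min_def)
    then show False
      using c(2)[of h] max[of "s - h" x] s x by auto
  qed
  then have "Z t x0 \<le> 0"
    using max[OF t, of x0] a by simp
  moreover have "\<eta> * t \<le> e"
    using t \<open>0 < e\<close> by (simp add: \<eta>_def field_simps)
  ultimately show "P t x0 \<le> k * t + e"
    by (simp add: Z_def algebra_simps)
qed

subsection \<open>Time integrals of bounded continuous functions\<close>

lemma AE_lebesgue_imp_negligible:
  assumes "AE x in lebesgue. P x"
  shows "negligible {x. \<not> P x}"
proof -
  obtain N where "N \<in> null_sets lebesgue" "{x \<in> space lebesgue. \<not> P x} \<subseteq> N"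
    using assms by (auto simp: eventually_ae_filter)
  then show ?thesis
    using negligible_subset[of N] by (simp add: negligible_iff_null_sets)
qed

text \<open>By continuity the set where the essential bound fails is open; it is also negligible,
  hence empty. An essential bound is thus a pointwise one.\<close>

lemma bounded_of_L_infinity_on:
  assumes "continuous_on (Q T) (\<lambda>(t, x). u t x)" "L_infinity_on (Q T) u"
  obtains C where "\<And>t x. 0 < t \<Longrightarrow> t < T \<Longrightarrow> \<bar>u t x\<bar> \<le> C"
proof -
  have op: "open (Q T)" unfolding Q_def by (intro open_Times) auto
  obtain C where "AE (t, x) in lebesgue_on (Q T). \<bar>u t x\<bar> \<le> C"
    using assms(2) by (auto simp: L_infinity_on_def)
  then have "AE p in lebesgue. p \<in> Q T \<longrightarrow> \<bar>case_prod u p\<bar> \<le> C"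
    using op by (subst (asm) AE_restrict_space_iff) (auto simp: case_prod_beta lmeasurable_iff_integrable)
  then have "negligible {p. \<not> (p \<in> Q T \<longrightarrow> \<bar>case_prod u p\<bar> \<le> C)}"
    by (rule AE_lebesgue_imp_negligible)
  moreover have "{p. \<not> (p \<in> Q T \<longrightarrow> \<bar>case_prod u p\<bar> \<le> C)} = Q T \<inter> (\<lambda>p. \<bar>case_prod u p\<bar>) -` {C<..}"
    by auto
  moreover have "open (Q T \<inter> (\<lambda>p. \<bar>case_prod u p\<bar>) -` {C<..})"
    using assms(1) op by (intro continuous_open_preimage continuous_intros) (auto simp: case_prod_beta)
  ultimately have "Q T \<inter> (\<lambda>p. \<bar>case_prod u p\<bar>) -` {C<..} = {}"
    using open_not_negligible by metis
  then have "\<bar>u t x\<bar> \<le> C" if "0 < t" "t < T" for t x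
    using that by (fastforce simp: Q_def set_eq_iff not_less)
  then show thesis by (rule that)
qed

lemma set_integrable_continuous_bounded:
  fixes h :: "'a::euclidean_space \<Rightarrow> real"
  assumes S: "S \<in> sets borel" "bounded S" and h: "continuous_on S h" "\<And>x. x \<in> S \<Longrightarrow> \<bar>h x\<bar> \<le> C"
  shows "set_integrable lborel S h"
  unfolding set_integrable_def
proof (rule integrableI_bounded_set[of S])
  show "(\<lambda>x. indicator S x *\<^sub>R h x) \<in> borel_measurable lborel"
    using borel_measurable_continuous_on_indicator[OF S(1) h(1)] by simp
qed (use S h emeasure_bounded_finite in auto)

lemma set_Fubini:
  fixes h :: "real \<Rightarrow> real \<Rightarrow> real"
  assumes "set_integrable lborel (A \<times> B) (\<lambda>(t, x). h t x)"
  shows set_integrable_fst: "set_integrable lborel A (\<lambda>t. LBINT x:B. h t x)"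
    and set_Fubini_integral: "(LBINT t:A. LBINT x:B. h t x) = (LBINT x:B. LBINT t:A. h t x)"
proof -
  define k where "k t x = indicator A t *\<^sub>R indicator B x *\<^sub>R h t x" for t x :: real
  have "case_prod k = (\<lambda>p. indicator (A \<times> B) p *\<^sub>R (case p of (t, x) \<Rightarrow> h t x))"
    by (auto simp: k_def indicator_def)
  then have k: "integrable (lborel \<Otimes>\<^sub>M lborel) (case_prod k)"
    using assms by (simp add: set_integrable_def lborel_prod)
  have 1: "(LBINT x. k t x) = indicator A t *\<^sub>R (LBINT x:B. h t x)" for t
    unfolding k_def set_lebesgue_integral_def by simp
  have 2: "(LBINT t. k t x) = indicator B x *\<^sub>R (LBINT t:A. h t x)" for x
    unfolding k_def set_lebesgue_integral_def
    by (simp add: mult.left_commute[of "indicator A _"])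
  show "set_integrable lborel A (\<lambda>t. LBINT x:B. h t x)"
    using lborel_pair.integrable_fst[OF k] unfolding 1 set_integrable_def .
  show "(LBINT t:A. LBINT x:B. h t x) = (LBINT x:B. LBINT t:A. h t x)"
    using lborel_pair.Fubini_integral[OF k] unfolding 1 2 by (simp add: set_lebesgue_integral_def)
qed

text \<open>The open interval keeps the value at time 0, where a solution carries no information,
  out of the integral.\<close>

definition time_integral :: "(real \<Rightarrow> real \<Rightarrow> real) \<Rightarrow> real \<Rightarrow> real \<Rightarrow> real" where
  "time_integral h t x = (LBINT s:{0<..<t}. h s x)"

text \<open>Collects what \<open>u\<close>, its power \<open>m + 1\<close> and
  \<open>poly f u\<close> have in common. Continuity up to time 0 is not included, so the facts
  below that reach time 0 rest on the bound \<open>C\<close>.\<close>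

locale bounded_continuous_strip =
  fixes h :: "real \<Rightarrow> real \<Rightarrow> real" and T C :: real
  assumes cont: "continuous_on (Q T) (\<lambda>(t, x). h t x)"
    and bound: "\<And>t x. 0 < t \<Longrightarrow> t < T \<Longrightarrow> \<bar>h t x\<bar> \<le> C"
begin

lemma continuous_on_time: "A \<subseteq> {0<..<T} \<Longrightarrow> continuous_on A (\<lambda>t. h t x)"
  using continuous_on_compose2[OF cont, of A "\<lambda>t. (t, x)"]
  by (auto simp: Q_def continuous_on_Pair continuous_on_id continuous_on_const image_subset_iff subset_eq)

lemma continuous_on_space: "0 < t \<Longrightarrow> t < T \<Longrightarrow> continuous_on A (h t)"
  using continuous_on_compose2[OF cont, of A "\<lambda>x. (t, x)"]
  by (auto simp: Q_def continuous_on_Pair continuous_on_id continuous_on_const image_subset_iff)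

lemma set_integrable_time:
  assumes "A \<in> sets borel" "A \<subseteq> {0<..<T}"
  shows "set_integrable lborel A (\<lambda>t. h t x)"
proof (rule set_integrable_continuous_bounded[where C = C])
  have "A \<subseteq> {0..T}"
    using assms(2) by auto
  then show "bounded A"
    using bounded_subset compact_imp_bounded compact_Icc by blast
qed (use assms bound continuous_on_time in auto)

text \<open>The intersection with \<open>{0<..}\<close> matters only for \<open>s = 0\<close>, where
  it removes the point 0 from the half-open interval.\<close>

lemma time_integral_diff:
  assumes "0 \<le> s" "s \<le> t" "t \<le> T"
  shows "time_integral h t x - time_integral h s x = (LBINT s:{s..<t} \<inter> {0<..}. h s x)"
proof -
  have "{0<..<t} = {0<..<s} \<union> ({s..<t} \<inter> {0<..})"
    using assms by auto
  then have "time_integral h t x = (LBINT s:{0<..<s} \<union> ({s..<t} \<inter> {0<..}). h s x)"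
    by (simp add: time_integral_def)
  also have "\<dots> = time_integral h s x + (LBINT s:{s..<t} \<inter> {0<..}. h s x)"
    unfolding time_integral_def using assms
    by (subst set_integral_Un) (auto intro!: set_integrable_time)
  finally show ?thesis by simp
qed

lemma time_integral_Lipschitz:
  assumes "0 \<le> s" "s \<le> t" "t \<le> T"
  shows "\<bar>time_integral h t x - time_integral h s x\<bar> \<le> C * (t - s)"
proof (cases "s = t")
  case False
  \<comment> \<open>The midpoint of \<open>s\<close> and \<open>t\<close> lies strictly inside the
    strip, so \<open>C\<close> bounds an absolute value there.\<close>
  then have "0 \<le> C"
    using bound[of "(s + t) / 2" 0] assms by auto
  define A where "A = {s..<t} \<inter> {0<..}"
  have A: "A \<in> sets borel" "A \<subseteq> {0<..<T}" "A \<subseteq> {s..t}"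
    using assms by (auto simp: A_def)
  have fin: "emeasure lborel A < \<infinity>"
    using A(3) by (intro emeasure_bounded_finite bounded_subset[OF compact_imp_bounded[OF compact_Icc]])
  have "\<bar>LBINT s:A. h s x\<bar> \<le> (LBINT s:A. \<bar>h s x\<bar>)"
    using set_integral_norm_bound[OF set_integrable_time[OF A(1,2)]] by simp
  also have "\<dots> \<le> (LBINT s:A. C)"
    using A bound fin set_integrable_time[OF A(1,2)]
    by (intro set_integral_mono set_integrable_abs) (auto simp: set_integrable_def)
  also have "\<dots> = C * measure lborel A"
    using A fin by (simp add: set_lebesgue_integral_def)
  also have "\<dots> \<le> C * measure lborel {s..t}"
    using A \<open>0 \<le> C\<close> assms by (intro mult_left_mono measure_mono_fmeasurable) (auto simp: fmeasurable_def)
  finally show ?thesis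
    using assms by (simp add: time_integral_diff A_def)
qed simp

text \<open>Dominated convergence along sequences, with the constant \<open>C\<close> on
  \<open>{0<..<t}\<close> as majorant.\<close>

lemma continuous_on_time_integral:
  assumes t: "0 \<le> t" "t \<le> T"
  shows "continuous_on UNIV (time_integral h t)"
proof (rule continuous_at_imp_continuous_on, intro ballI)
  fix x
  show "isCont (time_integral h t) x"
    unfolding continuous_at_sequentially comp_def
  proof (intro allI impI)
    fix X :: "nat \<Rightarrow> real" assume X: "X \<longlonglongrightarrow> x"
    have A: "{0<..<t} \<subseteq> {0<..<T}" using t by auto
    note i = set_integrable_time[OF _ A]
    have c: "(\<lambda>i. h s (X i)) \<longlonglongrightarrow> h s x" if "0 < s" "s < t" for s
      using continuous_on_space[of s UNIV] that t X
      by (auto simp: continuous_on_eq_continuous_at intro: isCont_tendsto_compose)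
    show "(\<lambda>n. time_integral h t (X n)) \<longlonglongrightarrow> time_integral h t x"
      unfolding time_integral_def set_lebesgue_integral_def
    proof (rule integral_dominated_convergence[where w = "\<lambda>s. indicator {0<..<t} s *\<^sub>R C"])
      show "integrable lborel (\<lambda>s. indicator {0<..<t} s *\<^sub>R C)"
        by (rule integrable_scaleR_left, rule integrable_real_indicator) (use t in auto)
    qed (use i c bound t in \<open>auto simp: set_integrable_def indicator_def intro!: AE_I2 borel_measurable_integrable\<close>)
  qed
qed

text \<open>The Lipschitz bound in time is uniform in space, so it combines with continuity in space
  at the single time \<open>t\<close>.\<close>

lemma continuous_on_time_integral_joint:
  assumes "t0 \<le> T"
  shows "continuous_on ({0..t0} \<times> A) (\<lambda>(t, x). time_integral h t x)"
  unfolding continuous_on_iff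
proof (intro ballI allI impI)
  fix p :: "real \<times> real" and e :: real assume p: "p \<in> {0..t0} \<times> A" and e: "0 < e"
  obtain t x where tx: "p = (t, x)" by force
  have t: "0 \<le> t" "t \<le> T" using p tx assms by auto
  define C' where "C' = max C 0 + 1"
  have C': "0 < C'" "C \<le> C'" by (auto simp: C'_def)
  obtain d where d: "0 < d" "\<And>y. \<bar>y - x\<bar> < d \<Longrightarrow> \<bar>time_integral h t y - time_integral h t x\<bar> < e / 2"
    using continuous_on_time_integral[OF t] e unfolding continuous_on_iff dist_real_def
    by (metis UNIV_I half_gt_zero)
  have "\<bar>time_integral h s y - time_integral h t x\<bar> < e"
    if s: "0 \<le> s" "s \<le> T" and sd: "\<bar>s - t\<bar> < e / (2 * C')" and yd: "\<bar>y - x\<bar> < d" for s y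
  proof -
    have "\<bar>time_integral h s y - time_integral h t y\<bar> \<le> C * \<bar>s - t\<bar>"
      using time_integral_Lipschitz[of s t y] time_integral_Lipschitz[of t s y] s t
      by (cases "s \<le> t") (auto simp: abs_minus_commute)
    also have "\<dots> \<le> C' * \<bar>s - t\<bar>"
      using C' by (intro mult_right_mono) auto
    also have "\<dots> < e / 2"
      using sd C' by (simp add: field_simps)
    finally show ?thesis using d(2)[OF yd] by linarith
  qed
  then have "dist (case q of (t, x) \<Rightarrow> time_integral h t x) (case p of (t, x) \<Rightarrow> time_integral h t x) < e"
    if "q \<in> {0..t0} \<times> A" "dist q p < min (e / (2 * C')) d" for q
    using that assms dist_fst_le[of q p] dist_snd_le[of q p] unfolding tx
    by (cases q) (auto simp: dist_real_def)
  moreover have "0 < min (e / (2 * C')) d"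
    using d(1) e C' by simp
  ultimately show "\<exists>d>0. \<forall>q\<in>{0..t0} \<times> A. dist q p < d \<longrightarrow>
      dist (case q of (t, x) \<Rightarrow> time_integral h t x) (case p of (t, x) \<Rightarrow> time_integral h t x) < e"
    by blast
qed

text \<open>The integrand is continuous only inside the strip, so the integral is split at some
  \<open>a\<close> between 0 and \<open>t\<close>: the first piece is constant and the fundamental
  theorem applies to the rest on a compact interval.\<close>

lemma time_integral_has_derivative:
  assumes t: "0 < t" "t < T"
  shows "((\<lambda>t. time_integral h t x) has_real_derivative h t x) (at t)"
proof -
  define a where "a = t / 2"
  define b where "b = (t + T) / 2"
  have ab: "0 < a" "a < t" "t < b" "b < T"
    using t by (auto simp: a_def b_def)
  have c: "continuous_on {a..b} (\<lambda>s. h s x)"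
    using ab by (intro continuous_on_time) auto
  have "((\<lambda>s. integral {a..s} (\<lambda>s. h s x)) has_real_derivative h t x) (at t within {a..b})"
    using ab by (intro integral_has_real_derivative c) auto
  then have "((\<lambda>s. integral {a..s} (\<lambda>s. h s x)) has_real_derivative h t x) (at t)"
    using ab at_within_interior[of t "{a..b}"] by simp
  then have "((\<lambda>s. time_integral h a x + integral {a..s} (\<lambda>s. h s x)) has_real_derivative h t x) (at t)"
    by (auto intro!: derivative_eq_intros)
  then show ?thesis
  proof (rule has_field_derivative_transform_within_open[of _ _ _ "{a<..<b}"])
    fix s assume s: "s \<in> {a<..<b}"
    have "time_integral h s x - time_integral h a x = (LBINT s:{a..<s}. h s x)"
      using s ab by (subst time_integral_diff) (auto intro!: arg_cong2[where f = "set_lebesgue_integral lborel"])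
    also have "\<dots> = integral {a..<s} (\<lambda>s. h s x)"
      using s ab by (intro set_borel_integral_eq_integral set_integrable_time) auto
    also have "\<dots> = integral {a..s} (\<lambda>s. h s x)"
      by (rule integral_subset_negligible[symmetric] integral_spike_set)
        (auto intro: negligible_subset[of "{s}"])
    finally show "time_integral h a x + integral {a..s} (\<lambda>s. h s x) = time_integral h s x"
      by simp
  qed (use ab in auto)
qed

lemma time_integral_bound:
  assumes "0 \<le> t" "t \<le> T"
  shows "\<bar>time_integral h t x\<bar> \<le> C * t"
  using time_integral_Lipschitz[of 0 t x] assms by (simp add: time_integral_def set_lebesgue_integral_def[of _ "{}"])

end

lemma bounded_continuous_strip_mono:
  assumes "bounded_continuous_strip h T C" "T' \<le> T" "C \<le> C'"
  shows "bounded_continuous_strip h T' C'"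
proof -
  interpret bounded_continuous_strip h T C by fact
  show ?thesis
  proof
    show "continuous_on (Q T') (\<lambda>(t, x). h t x)"
      by (rule continuous_on_subset[OF cont]) (use assms in \<open>auto simp: Q_def\<close>)
    show "\<bar>h t x\<bar> \<le> C'" if "0 < t" "t < T'" for t x
      using bound[of t x] that assms by auto
  qed
qed

subsection \<open>Weak solutions\<close>

lemma weak_solution_bounded:
  assumes "weak_solution m d f u u0" "0 < T"
  obtains C where "bounded_continuous_strip u T C"
proof -
  have "continuous_on (Q T) (\<lambda>(t, x). u t x)" "L_infinity_on (Q T) u"
    using assms by (auto simp: weak_solution_def intro: zero_less_one)
  then show thesis
    using bounded_of_L_infinity_on that unfolding bounded_continuous_strip_def by metis
qed

lemma weak_solution_strips:
  assumes m: "0 < m" and weak: "weak_solution m d f u u0" and T: "0 < T"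
  obtains C where "0 \<le> C" "bounded_continuous_strip u T C"
    "bounded_continuous_strip (\<lambda>t x. u t x powr (m + 1)) T C"
    "bounded_continuous_strip (\<lambda>t x. poly f (u t x)) T C"
proof -
  obtain A where "bounded_continuous_strip u T A"
    using weak_solution_bounded[OF weak T] .
  then interpret bounded_continuous_strip u T A .
  have nonneg: "0 \<le> u t x" if "0 < t" for t x
    using weak that by (simp add: weak_solution_def)
  have "continuous_on (Q T) (\<lambda>(t, x). u t x powr (m + 1))"
    using cont nonneg m unfolding case_prod_beta
    by (intro continuous_on_powr' continuous_intros) (auto simp: Q_def)
  moreover have "continuous_on (Q T) (\<lambda>(t, x). poly f (u t x))"
    using cont unfolding case_prod_beta by (intro continuous_intros)
  moreover have "\<bar>u t x powr (m + 1)\<bar> \<le> A powr (m + 1)" if "0 < t" "t < T" for t x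
    using bound[OF that] nonneg[OF that(1)] m by (auto intro!: powr_mono2)
  moreover have "bounded (poly f ` {- A..A})"
    by (intro compact_imp_bounded compact_continuous_image continuous_intros) auto
  then obtain B where B: "\<forall>y\<in>{- A..A}. \<bar>poly f y\<bar> \<le> B"
    by (auto simp: bounded_iff)
  then have "\<bar>poly f (u t x)\<bar> \<le> B" if "0 < t" "t < T" for t x
    using bound[OF that, of x] by (auto simp: abs_le_iff)
  moreover define C where "C = max 0 (max A (max (A powr (m + 1)) B))"
  ultimately show thesis
    using cont bound by (intro that[of C]) (unfold_locales, auto intro: order_trans simp: C_def le_max_iff_disj)
qed

lemma test_function_bounded:
  fixes w :: "real \<Rightarrow> real \<Rightarrow> real"
  assumes "continuous_on ({0..T} \<times> UNIV) (\<lambda>(t, x). w t x)"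
  obtains B where "0 \<le> B" "\<And>t x. 0 \<le> t \<Longrightarrow> t \<le> T \<Longrightarrow> - r \<le> x \<Longrightarrow> x \<le> r \<Longrightarrow> \<bar>w t x\<bar> \<le> B"
proof -
  have "bounded ((\<lambda>(t, x). w t x) ` ({0..T} \<times> {- r..r}))"
    by (intro compact_imp_bounded compact_continuous_image continuous_on_subset[OF assms] compact_Times) auto
  then obtain B where "0 < B" "\<And>p. p \<in> {0..T} \<times> {- r..r} \<Longrightarrow> \<bar>case_prod w p\<bar> \<le> B"
    unfolding bounded_pos by (auto simp: case_prod_beta)
  then show thesis
    by (intro that[of B]) force+
qed

lemma set_integrable_strip_mult:
  assumes "bounded_continuous_strip h T C" and w: "continuous_on ({0..T} \<times> UNIV) (\<lambda>(t, x). w t x)"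
  shows "set_integrable lborel ({0<..<T} \<times> {- r..r}) (\<lambda>(t, x). h t x * w t x)"
    and "0 < t \<Longrightarrow> t < T \<Longrightarrow> set_integrable lborel {- r..r} (\<lambda>x. h t x * w t x)"
    and "set_integrable lborel {0<..<T} (\<lambda>t. h t x * w t x)"
proof -
  interpret bounded_continuous_strip h T C by fact
  have bd: "\<exists>B. \<forall>t x. 0 < t \<longrightarrow> t < T \<longrightarrow> - r \<le> x \<longrightarrow> x \<le> r \<longrightarrow> \<bar>h t x * w t x\<bar> \<le> B" for r
  proof -
    obtain B where B: "0 \<le> B" "\<And>t x. 0 \<le> t \<Longrightarrow> t \<le> T \<Longrightarrow> - r \<le> x \<Longrightarrow> x \<le> r \<Longrightarrow> \<bar>w t x\<bar> \<le> B"
      using test_function_bounded[OF w] by metis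
    have "\<bar>h t x * w t x\<bar> \<le> C * B" if "0 < t" "t < T" "- r \<le> x" "x \<le> r" for t x
      using bound[of t x] B(2)[of t x] that by (auto simp: abs_mult intro!: mult_mono')
    then show ?thesis by blast
  qed
  have c: "continuous_on (Q T) (\<lambda>(t, x). h t x * w t x)"
  proof -
    have "Q T \<subseteq> {0..T} \<times> UNIV"
      by (auto simp: Q_def)
    then show ?thesis
      using cont continuous_on_subset[OF w, of "Q T"] unfolding case_prod_beta
      by (intro continuous_intros) auto
  qed
  obtain B where B: "\<And>t x. 0 < t \<Longrightarrow> t < T \<Longrightarrow> - r \<le> x \<Longrightarrow> x \<le> r \<Longrightarrow> \<bar>h t x * w t x\<bar> \<le> B"
    using bd[of r] by blast
  show "set_integrable lborel ({0<..<T} \<times> {- r..r}) (\<lambda>(t, x). h t x * w t x)"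
  proof (rule set_integrable_continuous_bounded)
    have "{0<..<T} \<times> {- r..r} \<subseteq> {0..T} \<times> {- r..r}" by auto
    then show "bounded ({0<..<T} \<times> {- r..r})"
      using bounded_subset compact_imp_bounded compact_Times compact_Icc by metis
    show "{0<..<T} \<times> {- r..r} \<in> sets borel"
      by (intro borel_Times) auto
    show "continuous_on ({0<..<T} \<times> {- r..r}) (\<lambda>(t, x). h t x * w t x)"
      by (rule continuous_on_subset[OF c]) (auto simp: Q_def)
    show "\<bar>case p of (t, x) \<Rightarrow> h t x * w t x\<bar> \<le> B" if "p \<in> {0<..<T} \<times> {- r..r}" for p
      using that B by auto
  qed
  show "set_integrable lborel {- r..r} (\<lambda>x. h t x * w t x)" if "0 < t" "t < T"
    using continuous_on_compose2[OF c, of "{- r..r}" "\<lambda>x. (t, x)"] that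
    by (intro borel_integrable_atLeastAtMost')
      (auto simp: Q_def continuous_on_Pair continuous_on_id continuous_on_const image_subset_iff)
  \<comment> \<open>The third claim concerns an arbitrary fixed \<open>x\<close>; the local bound
    covers it with radius \<open>\<bar>x\<bar>\<close>.\<close>
  obtain B where B: "\<And>t. 0 < t \<Longrightarrow> t < T \<Longrightarrow> \<bar>h t x * w t x\<bar> \<le> B"
  proof -
    obtain B where "\<forall>t y. 0 < t \<longrightarrow> t < T \<longrightarrow> - \<bar>x\<bar> \<le> y \<longrightarrow> y \<le> \<bar>x\<bar> \<longrightarrow> \<bar>h t y * w t y\<bar> \<le> B"
      using bd[of "\<bar>x\<bar>"] by blast
    then show thesis
      by (intro that[of B]) auto
  qed
  show "set_integrable lborel {0<..<T} (\<lambda>t. h t x * w t x)"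
  proof (rule set_integrable_continuous_bounded)
    show "bounded {0<..<T}"
      using bounded_subset[OF compact_imp_bounded[OF compact_Icc[of 0 T]], of "{0<..<T}"] by force
    show "continuous_on {0<..<T} (\<lambda>t. h t x * w t x)"
      using continuous_on_compose2[OF c, of "{0<..<T}" "\<lambda>t. (t, x)"]
      by (auto simp: Q_def continuous_on_Pair continuous_on_id continuous_on_const image_subset_iff)
  qed (use B in auto)
qed

section \<open>The integral identity tested with splines\<close>

definition weak_integrand ::
  "real \<Rightarrow> real \<Rightarrow> real poly \<Rightarrow> (real \<Rightarrow> real \<Rightarrow> real) \<Rightarrow> (real \<Rightarrow> real \<Rightarrow> real) \<Rightarrow>
    (real \<Rightarrow> real \<Rightarrow> real) \<Rightarrow> (real \<Rightarrow> real \<Rightarrow> real) \<Rightarrow> real \<Rightarrow> real \<Rightarrow> real" where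
  "weak_integrand m d f \<phi> \<phi>t \<phi>xx u t x =
    u t x * \<phi>t t x + d * (u t x powr (m + 1)) * \<phi>xx t x + poly f (u t x) * \<phi> t x"

text \<open>Integrability on the product serves Fubini's theorem; integrability on time slices
  serves to split the inner integral of a sum.\<close>

lemma set_integrable_weak_integrand:
  assumes m: "0 < m" and weak: "weak_solution m d f u u0" and T: "0 < T"
    and \<phi>: "C21_on_closure_Q T \<phi> \<phi>t \<phi>x \<phi>xx"
  shows "set_integrable lborel ({0<..<T} \<times> {- r..r}) (\<lambda>(t, x). weak_integrand m d f \<phi> \<phi>t \<phi>xx u t x)"
    and "0 < t \<Longrightarrow> t < T \<Longrightarrow> set_integrable lborel {- r..r} (weak_integrand m d f \<phi> \<phi>t \<phi>xx u t)"
proof -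
  obtain C where C: "bounded_continuous_strip u T C"
    "bounded_continuous_strip (\<lambda>t x. u t x powr (m + 1)) T C"
    "bounded_continuous_strip (\<lambda>t x. poly f (u t x)) T C"
    using weak_solution_strips[OF m weak T] by metis
  have w: "continuous_on ({0..T} \<times> UNIV) (\<lambda>(t, x). \<phi> t x)"
    "continuous_on ({0..T} \<times> UNIV) (\<lambda>(t, x). \<phi>t t x)"
    "continuous_on ({0..T} \<times> UNIV) (\<lambda>(t, x). \<phi>xx t x)"
    using \<phi> by (auto simp: C21_on_closure_Q_def)
  note i = set_integrable_strip_mult[OF C(1) w(2)] set_integrable_strip_mult[OF C(2) w(3)]
    set_integrable_strip_mult[OF C(3) w(1)]
  show "set_integrable lborel ({0<..<T} \<times> {- r..r}) (\<lambda>(t, x). weak_integrand m d f \<phi> \<phi>t \<phi>xx u t x)"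
    using set_integral_add(1)[OF set_integral_add(1)[OF i(1) set_integrable_mult_right[of d, OF i(4)]] i(7)]
    by (simp add: weak_integrand_def case_prod_unfold mult.assoc)
  show "set_integrable lborel {- r..r} (weak_integrand m d f \<phi> \<phi>t \<phi>xx u t)" if "0 < t" "t < T"
    using set_integral_add(1)[OF set_integral_add(1)[OF i(2)[OF that] set_integrable_mult_right[of d, OF i(5)[OF that]]] i(8)[OF that]]
    by (simp add: weak_integrand_def[abs_def] mult.assoc)
qed

lemma weak_solution_identity:
  assumes "weak_solution m d f u u0" "0 < r" "0 < T" "C21_on_closure_Q T \<phi> \<phi>t \<phi>x \<phi>xx"
    "\<forall>t\<in>{0..T}. \<forall>x. 0 \<le> \<phi> t x" "\<forall>t\<in>{0..T}. \<phi> t r = 0 \<and> \<phi> t (- r) = 0"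
  shows "(LBINT t:{0<..<T}. LBINT x:{- r..r}. weak_integrand m d f \<phi> \<phi>t \<phi>xx u t x)
    = (LBINT x:{- r..r}. u T x * \<phi> T x - u0 x * \<phi> 0 x)
      + d * (LBINT t:{0<..<T}. (u t r powr (m + 1)) * \<phi>x t r - (u t (- r) powr (m + 1)) * \<phi>x t (- r))"
  using assms unfolding weak_solution_def weak_integrand_def by blast

text \<open>A test function constant in time removes the \<open>\<phi>t\<close> term, and Fubini's
  theorem moves the time integral onto the nonlinear terms. What remains is the weak form of
  \<open>d * U'' = u - u0 - F\<close> at the fixed time \<open>t\<close>, where \<open>U\<close> and
  \<open>F\<close> are the time integrals of the power and of the reaction term. Symmetric second
  derivatives are what the barrier argument asks for.\<close>

lemma weak_solution_second_diff_tendsto: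
  assumes m: "0 < m" and d: "0 < d" and weak: "weak_solution m d f u u0" and t: "0 < t"
  shows "((\<lambda>h. second_diff h (time_integral (\<lambda>t x. u t x powr (m + 1)) t) x / h\<^sup>2) \<longlongrightarrow>
    (u t x - u0 x - time_integral (\<lambda>t x. poly f (u t x)) t x) / d) (at_right 0)"
proof -
  \<comment> \<open>The strip is open at its final time, so a larger horizon is taken to have
    \<open>u t\<close> continuous.\<close>
  define T where "T = t + 1"
  have T: "0 < T" "t < T" using t by (auto simp: T_def)
  obtain C where "bounded_continuous_strip u T C"
    "bounded_continuous_strip (\<lambda>t x. u t x powr (m + 1)) T C"
    "bounded_continuous_strip (\<lambda>t x. poly f (u t x)) T C"
    using weak_solution_strips[OF m weak T(1)] by metis
  then interpret u: bounded_continuous_strip u T C + P: bounded_continuous_strip "\<lambda>t x. u t x powr (m + 1)" T C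
    + F: bounded_continuous_strip "\<lambda>t x. poly f (u t x)" T C .
  let ?U = "time_integral (\<lambda>t x. u t x powr (m + 1)) t" and ?F = "time_integral (\<lambda>t x. poly f (u t x)) t"
  have u0: "continuous_on UNIV u0"
    using weak by (simp add: weak_solution_def initial_datum_def)
  have U: "continuous_on UNIV ?U" and F: "continuous_on UNIV ?F" and u: "continuous_on UNIV (u t)"
    using P.continuous_on_time_integral F.continuous_on_time_integral u.continuous_on_space t T by auto
  have sub: "continuous_on A k" if "continuous_on UNIV k" for A and k :: "real \<Rightarrow> real"
    using that continuous_on_subset by blast
  show ?thesis
  proof (rule second_diff_tendsto_of_weak[OF U])
    show "continuous_on UNIV (\<lambda>x. u t x - u0 x - ?F x)"
      by (intro continuous_intros u u0 F)
    show "d \<noteq> 0" using d by simp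
    fix h \<delta> r :: real assume h: "0 < h" and \<delta>: "0 < \<delta>" and r: "\<bar>x\<bar> + h + \<delta> \<le> r"
    define S where "S n y = spline h \<delta> n (y - x)" for n y
    have S': "(S (Suc n) has_real_derivative S n y) (at y)" if "0 < n" for n y
      using iffD1[OF DERIV_shift spline_has_derivative[OF that, of h \<delta> "y + - x"]]
      by (simp add: S_def[abs_def])
    have S_cont: "continuous_on A (S n)" for A n
      unfolding S_def[abs_def]
      by (intro continuous_on_compose2[OF continuous_on_spline[of UNIV]] continuous_intros) auto
    have S_cont2: "continuous_on ({0..t} \<times> UNIV) (\<lambda>(s :: real, y). S n y)" for n
      unfolding case_prod_beta by (intro continuous_on_compose2[OF S_cont[of UNIV]] continuous_intros) auto
    have C21: "C21_on_closure_Q t (\<lambda>s. S 3) (\<lambda>s y. 0) (\<lambda>s. S 2) (\<lambda>s. S 1)"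
      unfolding C21_on_closure_Q_def
      using S'[of 1] S'[of 2] S_cont2 by (auto simp: numeral_eq_Suc case_prod_beta)
    \<comment> \<open>Degree 3 gives the boundary condition on the test function; degree 2, its
      space derivative, makes the lateral flux vanish.\<close>
    have S0: "S n r = 0" "S n (- r) = 0" if "n \<in> {2, 3}" for n
      using r h \<delta> that by (auto simp: S_def intro!: spline_eq_0)
    let ?k = "weak_integrand m d f (\<lambda>s. S 3) (\<lambda>s y. 0) (\<lambda>s. S 1) u"
    have "(LBINT s:{0<..<t}. LBINT y:{- r..r}. ?k s y) = (LBINT y:{- r..r}. u t y * S 3 y - u0 y * S 3 y)"
      using weak_solution_identity[OF weak _ t C21] r h \<delta> S0 spline_nonneg by (simp add: S_def)
    moreover have "(LBINT s:{0<..<t}. LBINT y:{- r..r}. ?k s y) = (LBINT y:{- r..r}. LBINT s:{0<..<t}. ?k s y)"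
      by (rule set_Fubini_integral[OF set_integrable_weak_integrand(1)[OF m weak t C21]])
    moreover have "(LBINT s:{0<..<t}. ?k s y) = d * ?U y * S 1 y + ?F y * S 3 y" for y
    proof -
      have i: "set_integrable lborel {0<..<t} (\<lambda>s. u s y powr (m + 1))" "set_integrable lborel {0<..<t} (\<lambda>s. poly f (u s y))"
        using T by (auto intro!: P.set_integrable_time F.set_integrable_time)
      have "(LBINT s:{0<..<t}. ?k s y) = (LBINT s:{0<..<t}. (d * S 1 y) * u s y powr (m + 1) + S 3 y * poly f (u s y))"
        by (simp add: weak_integrand_def mult_ac)
      also have "\<dots> = d * S 1 y * ?U y + S 3 y * ?F y"
        using i by (subst set_integral_add) (auto simp: time_integral_def)
      finally show ?thesis by (simp add: mult_ac)
    qed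
    ultimately have "(LBINT y:{- r..r}. d * ?U y * S 1 y + ?F y * S 3 y) = (LBINT y:{- r..r}. u t y * S 3 y - u0 y * S 3 y)"
      by simp
    moreover have "(LBINT y:{- r..r}. k y) = integral {- r..r} k" if "continuous_on {- r..r} k" for k :: "real \<Rightarrow> real"
      using borel_integrable_atLeastAtMost'[OF that] by (rule set_borel_integral_eq_integral)
    ultimately have "integral {- r..r} (\<lambda>y. d * ?U y * S 1 y + ?F y * S 3 y) = integral {- r..r} (\<lambda>y. u t y * S 3 y - u0 y * S 3 y)"
      by (simp add: continuous_intros sub[OF U] sub[OF F] sub[OF u] sub[OF u0] S_cont)
    moreover have "integral {- r..r} (\<lambda>y. d * ?U y * S 1 y + ?F y * S 3 y)
        = integral {- r..r} (\<lambda>y. d * ?U y * S 1 y) + integral {- r..r} (\<lambda>y. ?F y * S 3 y)"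
      by (intro integral_add integrable_continuous_real continuous_intros sub[OF U] sub[OF F] S_cont)
    moreover have "integral {- r..r} (\<lambda>y. (u t y * S 3 y - u0 y * S 3 y) - ?F y * S 3 y)
        = integral {- r..r} (\<lambda>y. u t y * S 3 y - u0 y * S 3 y) - integral {- r..r} (\<lambda>y. ?F y * S 3 y)"
      by (intro integral_diff integrable_continuous_real continuous_intros sub[OF F] sub[OF u] sub[OF u0] S_cont)
    ultimately show "integral {- r..r} (\<lambda>y. d * ?U y * spline h \<delta> 1 (y - x))
        = integral {- r..r} (\<lambda>y. (u t y - u0 y - ?F y) * spline h \<delta> 3 (y - x))"
      unfolding S_def[symmetric] by (simp add: left_diff_distrib)
  qed
qed

section \<open>Disjointness of the initial data\<close>

text \<open>Write each power as base times \<open>m\<close>-th power and enlarge both bases of the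
  \<open>m\<close>-th powers to \<open>a + b\<close>.\<close>

lemma powr_add_strict_superadditive:
  fixes a b m :: real
  assumes "0 < m" "0 < a" "0 < b"
  shows "a powr (m + 1) + b powr (m + 1) < (a + b) powr (m + 1)"
proof -
  have "a powr (m + 1) + b powr (m + 1) = a * a powr m + b * b powr m"
    using assms by (simp add: powr_mult_base add.commute)
  also have "\<dots> < a * (a + b) powr m + b * (a + b) powr m"
    using assms by (intro add_strict_mono mult_strict_left_mono powr_less_mono2) auto
  also have "\<dots> = (a + b) powr (m + 1)"
    using assms by (simp add: powr_mult_base add.commute distrib_right[symmetric])
  finally show ?thesis .
qed

text \<open>In place of limits, one small \<epsilon> and one small time \<open>t0\<close> are fixed.
  Barriers bound \<open>U\<close> and \<open>V\<close> from above and \<open>U + V\<close> from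
  below at \<open>(t0, x0)\<close>; if both data were positive at \<open>x0\<close>, strict
  superadditivity would make these bounds incompatible.\<close>

lemma disjoint_weak_solutions_data:
  assumes m: "0 < m" and d: "0 < d"
    and weak_u: "weak_solution m d f u u0" and weak_v: "weak_solution m d f v v0"
    and disj: "\<And>t x. 0 < t \<Longrightarrow> u t x = 0 \<or> v t x = 0"
  shows "u0 x0 = 0 \<or> v0 x0 = 0"
proof (rule ccontr)
  assume contra: "\<not> (u0 x0 = 0 \<or> v0 x0 = 0)"
  define \<alpha> where "\<alpha> = u0 x0"
  define \<beta> where "\<beta> = v0 x0"
  have data: "continuous_on UNIV u0" "continuous_on UNIV v0" "0 \<le> u0 x0" "0 \<le> v0 x0"
    using weak_u weak_v by (auto simp: weak_solution_def initial_datum_def)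
  then have pos: "0 < \<alpha>" "0 < \<beta>"
    using contra by (auto simp: \<alpha>_def \<beta>_def order_less_le)
  have nonneg: "0 \<le> u t x" "0 \<le> v t x" if "0 < t" for t x
    using weak_u weak_v that by (auto simp: weak_solution_def)
  \<comment> \<open>At \<epsilon> = 0 this is the positive defect of superadditivity, and by
    continuity it stays positive for small \<epsilon>.\<close>
  define gap where "gap \<epsilon> = (\<alpha> + \<beta> - \<epsilon>) powr (m + 1) - (\<alpha> + \<epsilon>) powr (m + 1) - (\<beta> + \<epsilon>) powr (m + 1)" for \<epsilon>
  have "((\<lambda>\<epsilon>. gap \<epsilon>) \<longlongrightarrow> (\<alpha> + \<beta> - 0) powr (m + 1) - (\<alpha> + 0) powr (m + 1) - (\<beta> + 0) powr (m + 1)) (at_right 0)"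
    unfolding gap_def using pos by (intro tendsto_intros) auto
  moreover have "0 < (\<alpha> + \<beta> - 0) powr (m + 1) - (\<alpha> + 0) powr (m + 1) - (\<beta> + 0) powr (m + 1)"
    using powr_add_strict_superadditive[OF m pos] by simp
  ultimately have "\<forall>\<^sub>F \<epsilon> in at_right 0. 0 < gap \<epsilon>"
    by (rule order_tendstoD(1))
  moreover have "\<forall>\<^sub>F \<epsilon> in at_right 0. \<epsilon> < \<alpha> + \<beta>"
    using pos by (intro order_tendstoD(2)[OF tendsto_ident_at]) auto
  moreover have "\<forall>\<^sub>F \<epsilon>::real in at_right 0. 0 < \<epsilon>"
    by (rule eventually_at_right_less)
  ultimately have "\<forall>\<^sub>F \<epsilon> in at_right 0. 0 < gap \<epsilon> \<and> \<epsilon> < \<alpha> + \<beta> \<and> 0 < \<epsilon>"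
    by eventually_elim simp
  then obtain \<epsilon> where gap: "0 < gap \<epsilon>" and \<epsilon>: "\<epsilon> < \<alpha> + \<beta>" "0 < \<epsilon>"
    using eventually_happens'[OF trivial_limit_at_right_real] by blast
  \<comment> \<open>The bound on \<open>u + v\<close> incurs five errors of size at most
    \<open>e\<close>: two from the variation of the data, two from the reaction terms and one from
    the second derivative.\<close>
  define e where "e = \<epsilon> / 6"
  have e: "0 < e" using \<epsilon> by (simp add: e_def)
  obtain a1 where a1: "0 < a1" "\<And>x. \<bar>x - x0\<bar> < a1 \<Longrightarrow> \<bar>u0 x - \<alpha>\<bar> < e"
    using data(1) e unfolding continuous_on_iff dist_real_def \<alpha>_def by (metis UNIV_I)
  obtain a2 where a2: "0 < a2" "\<And>x. \<bar>x - x0\<bar> < a2 \<Longrightarrow> \<bar>v0 x - \<beta>\<bar> < e"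
    using data(2) e unfolding continuous_on_iff dist_real_def \<beta>_def by (metis UNIV_I)
  define a where "a = min a1 a2"
  have a: "0 < a" using a1 a2 by (simp add: a_def)
  have near: "\<bar>u0 x - \<alpha>\<bar> \<le> e" "\<bar>v0 x - \<beta>\<bar> \<le> e" if "\<bar>x - x0\<bar> < a" for x
    using a1(2)[of x] a2(2)[of x] that by (auto simp: a_def)
  obtain A where A: "0 \<le> A" "bounded_continuous_strip (\<lambda>t x. u t x powr (m + 1)) 2 A"
    "bounded_continuous_strip (\<lambda>t x. poly f (u t x)) 2 A"
    using weak_solution_strips[OF m weak_u, of 2] by auto
  obtain B where B: "0 \<le> B" "bounded_continuous_strip (\<lambda>t x. v t x powr (m + 1)) 2 B"
    "bounded_continuous_strip (\<lambda>t x. poly f (v t x)) 2 B"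
    using weak_solution_strips[OF m weak_v, of 2] by auto
  define C where "C = max A B"
  have C: "0 \<le> C" "A \<le> C" "B \<le> C"
    using A(1) by (auto simp: C_def)
  interpret Pu: bounded_continuous_strip "\<lambda>t x. u t x powr (m + 1)" 2 C
    using A(2) C by (auto intro: bounded_continuous_strip_mono)
  interpret Fu: bounded_continuous_strip "\<lambda>t x. poly f (u t x)" 2 C
    using A(3) C by (auto intro: bounded_continuous_strip_mono)
  interpret Pv: bounded_continuous_strip "\<lambda>t x. v t x powr (m + 1)" 2 C
    using B(2) C by (auto intro: bounded_continuous_strip_mono)
  interpret Fv: bounded_continuous_strip "\<lambda>t x. poly f (v t x)" 2 C
    using B(3) C by (auto intro: bounded_continuous_strip_mono)
  define U where "U = time_integral (\<lambda>t x. u t x powr (m + 1))"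
  define V where "V = time_integral (\<lambda>t x. v t x powr (m + 1))"
  define F where "F = time_integral (\<lambda>t x. poly f (u t x))"
  define G where "G = time_integral (\<lambda>t x. poly f (v t x))"
  have U2: "((\<lambda>h. second_diff h (U t) x / h\<^sup>2) \<longlongrightarrow> (u t x - u0 x - F t x) / d) (at_right 0)"
    and V2: "((\<lambda>h. second_diff h (V t) x / h\<^sup>2) \<longlongrightarrow> (v t x - v0 x - G t x) / d) (at_right 0)"
    if "0 < t" for t x
    unfolding U_def V_def F_def G_def
    using weak_solution_second_diff_tendsto[OF m d weak_u that]
      weak_solution_second_diff_tendsto[OF m d weak_v that] by auto
  define kw where "kw = (\<alpha> + \<beta> - \<epsilon>) powr (m + 1)"
  \<comment> \<open>One \<open>K\<close> for all three barriers: \<open>C \<le> K\<close> gives the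
    lateral bounds for \<open>U\<close> and \<open>V\<close>, and \<open>kw \<le> K\<close> gives
    the one for \<open>- (U + V)\<close>, whose rate is \<open>- kw\<close>.\<close>
  define K where "K = C + kw"
  have K: "0 \<le> K" "C \<le> K" "kw \<le> K"
    using C by (auto simp: K_def kw_def)
  \<comment> \<open>The three bounds keep \<open>t0\<close> well inside the strip of length 2, make
    the reaction integrals at most \<open>e\<close>, and make \<open>d\<close> times the curvature
    of the barrier at most \<open>e\<close>. The summands 1 keep the denominators positive.\<close>
  define t0 where "t0 = min 1 (min (e / (C + 1)) (e * a\<^sup>2 / (2 * d * (K + 1))))"
  have t0: "0 < t0" "t0 \<le> 1" "t0 \<le> e / (C + 1)" "t0 \<le> e * a\<^sup>2 / (2 * d * (K + 1))"
    using e C K a d by (auto simp: t0_def)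
  define \<kappa> where "\<kappa> = 2 * K * t0 / a\<^sup>2"
  have "2 * d * (K + 1) * t0 \<le> e * a\<^sup>2"
    using t0(4) d K by (simp add: pos_le_divide_eq mult.commute)
  moreover have "2 * d * K * t0 \<le> 2 * d * (K + 1) * t0"
    using t0 d K by simp
  ultimately have \<kappa>: "d * \<kappa> \<le> e"
    using a by (simp add: \<kappa>_def divide_le_eq mult_ac)
  have Fsmall: "\<bar>F t x\<bar> \<le> e" "\<bar>G t x\<bar> \<le> e" if "0 < t" "t \<le> t0" for t x
  proof -
    have "C * t \<le> (C + 1) * t0"
      using that C by (intro mult_mono) auto
    also have "\<dots> \<le> e"
      using t0(3) C by (simp add: pos_le_divide_eq mult.commute)
    finally have "C * t \<le> e" .
    then show "\<bar>F t x\<bar> \<le> e" "\<bar>G t x\<bar> \<le> e"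
      using Fu.time_integral_bound[of t x] Fv.time_integral_bound[of t x] that t0
      by (auto simp: F_def G_def)
  qed
  have init: "U 0 x = 0" "V 0 x = 0" for x
    by (simp_all add: U_def V_def time_integral_def set_lebesgue_integral_def)
  have UV_nonneg: "0 \<le> U t x" "0 \<le> V t x" for t x
    unfolding U_def V_def time_integral_def set_lebesgue_integral_def
    by (auto intro!: Bochner_Integration.integral_nonneg)
  have UV_bound: "U t x \<le> C * t" "V t x \<le> C * t" if "0 \<le> t" "t \<le> t0" for t x
    using Pu.time_integral_bound[of t x] Pv.time_integral_bound[of t x] that t0
    by (auto simp: U_def V_def)
  have UV_deriv: "((\<lambda>s. U s x) has_real_derivative u t x powr (m + 1)) (at t)"
    "((\<lambda>s. V s x) has_real_derivative v t x powr (m + 1)) (at t)" if "0 < t" "t \<le> t0" for t x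
    unfolding U_def V_def
    using Pu.time_integral_has_derivative[of t x] Pv.time_integral_has_derivative[of t x] that t0 by auto
  have UV_cont: "continuous_on ({0..t0} \<times> S) (\<lambda>(t, x). U t x)" "continuous_on ({0..t0} \<times> S) (\<lambda>(t, x). V t x)" for S
    unfolding U_def V_def
    using Pu.continuous_on_time_integral_joint Pv.continuous_on_time_integral_joint t0 by auto
  have "U t0 x0 \<le> (\<alpha> + \<epsilon>) powr (m + 1) * t0"
  proof (rule barrier_bound[OF a K(1) UV_cont(1) _ _ UV_deriv(1) U2])
    fix t x assume t: "0 < t" "t \<le> t0" and x: "\<bar>x - x0\<bar> < a"
      and le: "(u t x - u0 x - F t x) / d \<le> 2 * K * t0 / a\<^sup>2"
    have "u t x - u0 x - F t x \<le> d * \<kappa>"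
      using le d by (simp add: \<kappa>_def divide_le_eq mult.commute)
    then have "u t x \<le> \<alpha> + \<epsilon>"
      using \<kappa> near[OF x] Fsmall[OF t, of x] e_def \<epsilon>(2) by linarith
    then show "u t x powr (m + 1) \<le> (\<alpha> + \<epsilon>) powr (m + 1)"
      using nonneg[OF t(1)] m by (intro powr_mono2) auto
  next
    fix t x assume t: "0 \<le> t" "t \<le> t0"
    have "C * t \<le> ((\<alpha> + \<epsilon>) powr (m + 1) + K) * t"
      using t K by (intro mult_right_mono) (auto intro: add_increasing)
    then show "U t x \<le> ((\<alpha> + \<epsilon>) powr (m + 1) + K) * t"
      using UV_bound(1)[OF t, of x] by simp
  qed (use init t0 in auto)
  moreover have "V t0 x0 \<le> (\<beta> + \<epsilon>) powr (m + 1) * t0"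
  proof (rule barrier_bound[OF a K(1) UV_cont(2) _ _ UV_deriv(2) V2])
    fix t x assume t: "0 < t" "t \<le> t0" and x: "\<bar>x - x0\<bar> < a"
      and le: "(v t x - v0 x - G t x) / d \<le> 2 * K * t0 / a\<^sup>2"
    have "v t x - v0 x - G t x \<le> d * \<kappa>"
      using le d by (simp add: \<kappa>_def divide_le_eq mult.commute)
    then have "v t x \<le> \<beta> + \<epsilon>"
      using \<kappa> near[OF x] Fsmall[OF t, of x] e_def \<epsilon>(2) by linarith
    then show "v t x powr (m + 1) \<le> (\<beta> + \<epsilon>) powr (m + 1)"
      using nonneg[OF t(1)] m by (intro powr_mono2) auto
  next
    fix t x assume t: "0 \<le> t" "t \<le> t0"
    have "C * t \<le> ((\<beta> + \<epsilon>) powr (m + 1) + K) * t"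
      using t K by (intro mult_right_mono) (auto intro: add_increasing)
    then show "V t x \<le> ((\<beta> + \<epsilon>) powr (m + 1) + K) * t"
      using UV_bound(2)[OF t, of x] by simp
  qed (use init t0 in auto)
  \<comment> \<open>The lower bound for the sum is an upper bound for its negative; a small second
    derivative of the negative forces \<open>u + v\<close> to be at least
    \<open>\<alpha> + \<beta> - \<epsilon>\<close>.\<close>
  moreover have "- (U t0 x0 + V t0 x0) \<le> - kw * t0"
  proof (rule barrier_bound[where P = "\<lambda>t x. - (U t x + V t x)"
        and Pt = "\<lambda>t x. - (u t x powr (m + 1) + v t x powr (m + 1))"
        and Pxx = "\<lambda>t x. - ((u t x - u0 x - F t x) / d + (v t x - v0 x - G t x) / d)", OF a K(1)])
    show "continuous_on ({0..t0} \<times> {x0 - a..x0 + a}) (\<lambda>(t, x). - (U t x + V t x))"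
      using UV_cont unfolding case_prod_beta by (intro continuous_intros)
    show "((\<lambda>s. - (U s x + V s x)) has_real_derivative - (u t x powr (m + 1) + v t x powr (m + 1))) (at t)"
      if "0 < t" "t \<le> t0" for t x
      using UV_deriv[OF that] by (auto intro!: derivative_intros)
    show "((\<lambda>h. second_diff h (\<lambda>x. - (U t x + V t x)) x / h\<^sup>2) \<longlongrightarrow>
        - ((u t x - u0 x - F t x) / d + (v t x - v0 x - G t x) / d)) (at_right 0)" if "0 < t" for t x
    proof -
      have "second_diff h (\<lambda>x. - (U t x + V t x)) x / h\<^sup>2
        = - (second_diff h (U t) x / h\<^sup>2 + second_diff h (V t) x / h\<^sup>2)" for h
        by (simp add: second_diff_def add_divide_distrib[symmetric] minus_divide_left)
      then show ?thesis
        using tendsto_minus[OF tendsto_add[OF U2[OF that] V2[OF that]]] by simp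
    qed
    fix t x assume t: "0 < t" "t \<le> t0" and x: "\<bar>x - x0\<bar> < a"
      and le: "- ((u t x - u0 x - F t x) / d + (v t x - v0 x - G t x) / d) \<le> 2 * K * t0 / a\<^sup>2"
    have "- ((u t x - u0 x - F t x) + (v t x - v0 x - G t x)) / d \<le> \<kappa>"
      using le by (simp add: \<kappa>_def add_divide_distrib diff_divide_distrib)
    then have "- ((u t x - u0 x - F t x) + (v t x - v0 x - G t x)) \<le> d * \<kappa>"
      using d by (simp only: pos_divide_le_eq mult.commute)
    then have "\<alpha> + \<beta> - \<epsilon> \<le> u t x + v t x"
      using \<kappa> near[OF x] Fsmall[OF t, of x] e_def \<epsilon>(2) by linarith
    then have "kw \<le> (u t x + v t x) powr (m + 1)"
      unfolding kw_def using \<epsilon> m by (intro powr_mono2) auto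
    \<comment> \<open>Disjointness enters here: one summand vanishes and
      \<open>0 powr (m + 1) = 0\<close>, so the lower bound on \<open>u + v\<close> passes to the
      sum of the two time derivatives.\<close>
    also have "\<dots> = u t x powr (m + 1) + v t x powr (m + 1)"
      using disj[OF t(1), of x] by auto
    finally show "- (u t x powr (m + 1) + v t x powr (m + 1)) \<le> - kw"
      by simp
  next
    fix t x assume t: "0 \<le> t" "t \<le> t0"
    have "0 \<le> (- kw + K) * t"
      using t K by simp
    then show "- (U t x + V t x) \<le> (- kw + K) * t"
      using UV_nonneg[of t x] by linarith
  qed (use init t0 in auto)
  ultimately have "kw * t0 \<le> ((\<alpha> + \<epsilon>) powr (m + 1) + (\<beta> + \<epsilon>) powr (m + 1)) * t0"
    by (simp add: distrib_right)
  then have "kw \<le> (\<alpha> + \<epsilon>) powr (m + 1) + (\<beta> + \<epsilon>) powr (m + 1)"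
    using t0(1) by (simp only: mult_le_cancel_right_pos)
  then show False
    using gap by (simp add: gap_def kw_def)
qed

section \<open>Additivity of the integral identity\<close>

lemma disjoint_of_supp_in:
  assumes "supp_in (Q T) u \<inter> supp_in (Q T) v = {}" "0 < t" "t < T"
  shows "u t x = 0 \<or> v t x = 0"
proof (rule ccontr)
  assume "\<not> (u t x = 0 \<or> v t x = 0)"
  then have "(t, x) \<in> {(t, x) \<in> Q T. u t x \<noteq> 0}" "(t, x) \<in> {(t, x) \<in> Q T. v t x \<noteq> 0}"
    using assms by (auto simp: Q_def)
  moreover have "{(t, x) \<in> Q T. w t x \<noteq> 0} \<subseteq> supp_in (Q T) w" for w
    unfolding supp_in_def by (intro closure_of_subset) auto
  ultimately have "(t, x) \<in> supp_in (Q T) u \<inter> supp_in (Q T) v"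
    by (meson IntI subsetD)
  then show False
    using assms(1) by simp
qed

theorem proposition2p3:
  fixes m d :: real and f :: "real poly"
    and u v :: "real \<Rightarrow> real \<Rightarrow> real" and u0 v0 :: "real \<Rightarrow> real"
  assumes "m > 0" and "d = inverse (m + 1)" and "poly f 0 = 0"
    and "weak_solution m d f u u0"
    and "weak_solution m d f v v0"
    and "\<And>T. T > 0 \<Longrightarrow> supp_in (Q T) u \<inter> supp_in (Q T) v = {}"
  shows "weak_solution m d f (\<lambda>t x. u t x + v t x) (\<lambda>x. u0 x + v0 x)"
proof -
  note m = assms(1) and f0 = assms(3) and weak_u = assms(4) and weak_v = assms(5)
  have d: "0 < d" using assms(1,2) by simp
  have disj: "u t x = 0 \<or> v t x = 0" if "0 < t" for t x
    using disjoint_of_supp_in[of "t + 1" u v t x] assms(6)[of "t + 1"] that by simp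
  have powr_sum: "(u t x + v t x) powr (m + 1) = u t x powr (m + 1) + v t x powr (m + 1)" if "0 < t" for t x
    using disj[OF that, of x] by auto
  have f_sum: "poly f (u t x + v t x) = poly f (u t x) + poly f (v t x)" if "0 < t" for t x
    using disj[OF that, of x] f0 by auto
  \<comment> \<open>This is what keeps \<open>u0 + v0\<close> below 1, as an admissible initial
    datum requires.\<close>
  have data: "u0 x = 0 \<or> v0 x = 0" for x
    by (rule disjoint_weak_solutions_data[OF m d weak_u weak_v disj])
  have u0: "continuous_on UNIV u0" "\<And>x. 0 \<le> u0 x \<and> u0 x \<le> 1" and v0: "continuous_on UNIV v0" "\<And>x. 0 \<le> v0 x \<and> v0 x \<le> 1"
    using weak_u weak_v by (auto simp: weak_solution_def initial_datum_def)
  have "0 \<le> u0 x + v0 x \<and> u0 x + v0 x \<le> 1" for x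
    using data[of x] u0(2)[of x] v0(2)[of x] by auto
  then have init: "initial_datum (\<lambda>x. u0 x + v0 x)"
    using u0(1) v0(1) by (auto simp: initial_datum_def intro!: continuous_intros)
  have nonneg: "\<forall>t>0. \<forall>x. 0 \<le> u t x + v t x"
    using weak_u weak_v by (auto simp: weak_solution_def)
  have cont: "continuous_on (Q T) (\<lambda>(t, x). u t x + v t x)"
    and L_inf: "L_infinity_on (Q T) (\<lambda>t x. u t x + v t x)" if T: "0 < T" for T
  proof -
    obtain A B where "bounded_continuous_strip u T A" "bounded_continuous_strip v T B"
      using weak_solution_bounded[OF weak_u T] weak_solution_bounded[OF weak_v T] by metis
    then interpret u: bounded_continuous_strip u T A + v: bounded_continuous_strip v T B .
    show c: "continuous_on (Q T) (\<lambda>(t, x). u t x + v t x)"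
      using u.cont v.cont unfolding case_prod_beta by (intro continuous_intros)
    have "open (Q T)"
      unfolding Q_def by (intro open_Times) auto
    then have S: "Q T \<in> sets lebesgue" by simp
    have "\<bar>u t x + v t x\<bar> \<le> A + B" if "(t, x) \<in> Q T" for t x
      using u.bound[of t x] v.bound[of t x] that by (auto simp: Q_def)
    then have "AE (t, x) in lebesgue_on (Q T). \<bar>u t x + v t x\<bar> \<le> A + B"
      by (intro AE_I2) auto
    then show "L_infinity_on (Q T) (\<lambda>t x. u t x + v t x)"
      unfolding L_infinity_on_def using continuous_imp_measurable_on_sets_lebesgue[OF c S] by blast
  qed
  have "(LBINT t:{0<..<T}. LBINT x:{- r..r}. weak_integrand m d f \<phi> \<phi>t \<phi>xx (\<lambda>t x. u t x + v t x) t x)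
      = (LBINT x:{- r..r}. (u T x + v T x) * \<phi> T x - (u0 x + v0 x) * \<phi> 0 x)
        + d * (LBINT t:{0<..<T}. ((u t r + v t r) powr (m + 1)) * \<phi>x t r
          - ((u t (- r) + v t (- r)) powr (m + 1)) * \<phi>x t (- r))" (is "?L = ?R1 + d * ?R2")
    if r: "0 < r" and T: "0 < T" and \<phi>: "C21_on_closure_Q T \<phi> \<phi>t \<phi>x \<phi>xx"
      "\<forall>t\<in>{0..T}. \<forall>x. 0 \<le> \<phi> t x" "\<forall>t\<in>{0..T}. \<phi> t r = 0 \<and> \<phi> t (- r) = 0"
    for r T \<phi> \<phi>t \<phi>x \<phi>xx
  proof -
    let ?k = "weak_integrand m d f \<phi> \<phi>t \<phi>xx"
    note iu = set_integrable_weak_integrand[OF m weak_u T \<phi>(1), where r = r]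
    note iv = set_integrable_weak_integrand[OF m weak_v T \<phi>(1), where r = r]
    have "?L = (LBINT t:{0<..<T}. (LBINT x:{- r..r}. ?k u t x) + (LBINT x:{- r..r}. ?k v t x))"
    proof (rule set_lebesgue_integral_cong)
      show "\<forall>t. t \<in> {0<..<T} \<longrightarrow> (LBINT x:{- r..r}. ?k (\<lambda>t x. u t x + v t x) t x)
          = (LBINT x:{- r..r}. ?k u t x) + (LBINT x:{- r..r}. ?k v t x)"
      proof (intro allI impI)
        fix t assume t: "t \<in> {0<..<T}"
        have "?k (\<lambda>t x. u t x + v t x) t x = ?k u t x + ?k v t x" for x
          using t by (simp add: weak_integrand_def powr_sum f_sum) (simp add: algebra_simps)
        then show "(LBINT x:{- r..r}. ?k (\<lambda>t x. u t x + v t x) t x)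
          = (LBINT x:{- r..r}. ?k u t x) + (LBINT x:{- r..r}. ?k v t x)"
          using t by (simp add: set_integral_add(2) iu(2) iv(2))
      qed
    qed simp
    also have "\<dots> = (LBINT t:{0<..<T}. LBINT x:{- r..r}. ?k u t x) + (LBINT t:{0<..<T}. LBINT x:{- r..r}. ?k v t x)"
      by (intro set_integral_add set_integrable_fst iu iv)
    finally have L: "?L = \<dots>" .
    \<comment> \<open>The value at the final time \<open>T\<close> needs continuity of
      \<open>w T\<close>, hence a strip reaching beyond \<open>T\<close>.\<close>
    have int_data: "set_integrable lborel {- r..r} (\<lambda>x. w T x * \<phi> T x - w0 x * \<phi> 0 x)"
      if w: "weak_solution m d f w w0" for w w0
    proof (rule borel_integrable_atLeastAtMost')
      obtain A where "bounded_continuous_strip w (T + 1) A"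
        using weak_solution_bounded[OF w] T by (metis add_pos_pos zero_less_one)
      then have "continuous_on {- r..r} (w T)"
        using bounded_continuous_strip.continuous_on_space T by auto
      moreover have "continuous_on {- r..r} w0"
        using w by (auto simp: weak_solution_def initial_datum_def intro: continuous_on_subset)
      moreover have "continuous_on {- r..r} (\<lambda>x. \<phi> t x)" if "t \<in> {0..T}" for t
      proof -
        have c: "continuous_on ({0..T} \<times> UNIV) (\<lambda>(t, x). \<phi> t x)"
          using \<phi>(1) by (simp add: C21_on_closure_Q_def)
        show ?thesis
          using continuous_on_compose2[OF c, of "{- r..r}" "\<lambda>x. (t, x)"] that
          by (auto simp: continuous_on_Pair continuous_on_id continuous_on_const image_subset_iff)
      qed
      ultimately show "continuous_on {- r..r} (\<lambda>x. w T x * \<phi> T x - w0 x * \<phi> 0 x)"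
        using T by (intro continuous_intros) auto
    qed
    have "?R1 = (LBINT x:{- r..r}. (u T x * \<phi> T x - u0 x * \<phi> 0 x) + (v T x * \<phi> T x - v0 x * \<phi> 0 x))"
      by (simp add: algebra_simps)
    also have "\<dots> = (LBINT x:{- r..r}. u T x * \<phi> T x - u0 x * \<phi> 0 x) + (LBINT x:{- r..r}. v T x * \<phi> T x - v0 x * \<phi> 0 x)"
      by (intro set_integral_add int_data weak_u weak_v)
    finally have R1: "?R1 = \<dots>" .
    have int_bdry: "set_integrable lborel {0<..<T} (\<lambda>t. (w t r powr (m + 1)) * \<phi>x t r - (w t (- r) powr (m + 1)) * \<phi>x t (- r))"
      if w: "weak_solution m d f w w0" for w w0
    proof -
      obtain C where "bounded_continuous_strip (\<lambda>t x. w t x powr (m + 1)) T C"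
        using weak_solution_strips[OF m w T] by metis
      moreover have "continuous_on ({0..T} \<times> UNIV) (\<lambda>(t, x). \<phi>x t x)"
        using \<phi>(1) by (simp add: C21_on_closure_Q_def)
      ultimately show ?thesis
        by (intro set_integral_diff set_integrable_strip_mult(3))
    qed
    have "?R2 = (LBINT t:{0<..<T}. ((u t r powr (m + 1)) * \<phi>x t r - (u t (- r) powr (m + 1)) * \<phi>x t (- r))
        + ((v t r powr (m + 1)) * \<phi>x t r - (v t (- r) powr (m + 1)) * \<phi>x t (- r)))"
      by (intro set_lebesgue_integral_cong) (auto simp: powr_sum, simp add: algebra_simps)
    also have "\<dots> = (LBINT t:{0<..<T}. (u t r powr (m + 1)) * \<phi>x t r - (u t (- r) powr (m + 1)) * \<phi>x t (- r))
        + (LBINT t:{0<..<T}. (v t r powr (m + 1)) * \<phi>x t r - (v t (- r) powr (m + 1)) * \<phi>x t (- r))"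
      by (intro set_integral_add int_bdry[OF weak_u] int_bdry[OF weak_v])
    finally have R2: "?R2 = \<dots>" .
    show ?thesis
      unfolding L R1 R2 weak_solution_identity[OF weak_u r T \<phi>] weak_solution_identity[OF weak_v r T \<phi>]
      by (simp add: algebra_simps)
  qed
  then show ?thesis
    using init nonneg cont L_inf unfolding weak_solution_def weak_integrand_def by blast
qed

end
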